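(* The \textsc{max $(k,n-k)$-cut} problem, parameterized by the standard parameter $p$, is fixed-parameter tractable: there is an algorithm that, given a graph $G=(V,E)$ with $n$ vertices and integers $k,p$, decides whether there exists $V'\subseteq V$ with $|V'|=k$ such that at least $p$ edges have exactly one endpoint in $V'$, in time $f(p)\cdot n^{O(1)}$ for some computable function $f$. *)

theory Defs
  imports Main "HOL-Library.Ramsey"
begin

text \<open>
  Algorithms are programs of a unit-cost random access machine: finitely many of the integer
  registers are used by any one program, and there is an integer-addressed integer memory with
  indirect addressing. Every assignment, store and test takes one step. Expressions have a size
  fixed by the program, and the only arithmetic is addition and subtraction. In \<open>t\<close>
  steps the bit length of the numbers thus grows by \<open>O(t)\<close> at most, and this time measure is
  polynomially related to that of Turing machines.
\<close>

datatype aexp = Const int | Reg nat | Load aexp | Plus aexp aexp | Minus aexp aexp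

datatype bexp = Less aexp aexp | NotB bexp | AndB bexp bexp

datatype com =
    Skip
  | Assign nat aexp
  | Store aexp aexp
  | Seq com com
  | Cond bexp com com
  | While bexp com

record state =
  reg :: "nat \<Rightarrow> int"
  mem :: "int \<Rightarrow> int"

fun aval :: "aexp \<Rightarrow> state \<Rightarrow> int" where
  "aval (Const z) s = z"
| "aval (Reg x) s = reg s x"
| "aval (Load a) s = mem s (aval a s)"
| "aval (Plus a b) s = aval a s + aval b s"
| "aval (Minus a b) s = aval a s - aval b s"

fun bval :: "bexp \<Rightarrow> state \<Rightarrow> bool" where
  "bval (Less a b) s \<longleftrightarrow> aval a s < aval b s"
| "bval (NotB b) s \<longleftrightarrow> \<not> bval b s"
| "bval (AndB b c) s \<longleftrightarrow> bval b s \<and> bval c s"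

text \<open>\<open>exec c s t s'\<close>: started in \<open>s\<close>, program \<open>c\<close> halts after exactly \<open>t\<close> steps in \<open>s'\<close>.\<close>

inductive exec :: "com \<Rightarrow> state \<Rightarrow> nat \<Rightarrow> state \<Rightarrow> bool" where
  Skip: "exec Skip s 1 s"
| Assign: "exec (Assign x a) s 1 (s\<lparr>reg := (reg s)(x := aval a s)\<rparr>)"
| Store: "exec (Store a b) s 1 (s\<lparr>mem := (mem s)(aval a s := aval b s)\<rparr>)"
| Seq: "exec c s t s' \<Longrightarrow> exec d s' t' s'' \<Longrightarrow> exec (Seq c d) s (t + t') s''"
| CondTrue: "bval b s \<Longrightarrow> exec c s t s' \<Longrightarrow> exec (Cond b c d) s (t + 1) s'"
| CondFalse: "\<not> bval b s \<Longrightarrow> exec d s t s' \<Longrightarrow> exec (Cond b c d) s (t + 1) s'"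
| WhileFalse: "\<not> bval b s \<Longrightarrow> exec (While b c) s 1 s"
| WhileTrue: "bval b s \<Longrightarrow> exec c s t s' \<Longrightarrow> exec (While b c) s' t' s'' \<Longrightarrow>
    exec (While b c) s (t + t' + 1) s''"

inductive_cases exec_SkipE: "exec Skip s t s'"
  and exec_AssignE: "exec (Assign x a) s t s'"
  and exec_StoreE: "exec (Store a b) s t s'"
  and exec_SeqE: "exec (Seq c d) s t s'"
  and exec_CondE: "exec (Cond b c d) s t s'"
  and exec_WhileE: "exec (While b c) s t s'"

lemma exec_deterministic:
  "exec c s t s' \<Longrightarrow> exec c s u r \<Longrightarrow> t = u \<and> s' = r"
proof (induction arbitrary: u r rule: exec.induct)
  case Skip then show ?case by (auto elim: exec_SkipE)
next
  case Assign then show ?case by (auto elim: exec_AssignE)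
next
  case Store then show ?case by (auto elim: exec_StoreE)
next
  case (Seq c s t s' d t' s'')
  from Seq.prems show ?case by (rule exec_SeqE) (use Seq.IH in fastforce)
next
  case (CondTrue b s c t s' d)
  from CondTrue.prems show ?case
    by (rule exec_CondE) (use CondTrue.hyps CondTrue.IH in fastforce)+
next
  case (CondFalse b s d t s' c)
  from CondFalse.prems show ?case
    by (rule exec_CondE) (use CondFalse.hyps CondFalse.IH in fastforce)+
next
  case WhileFalse then show ?case by (auto elim: exec_WhileE)
next
  case (WhileTrue b s c t s' t' s'')
  from WhileTrue.prems show ?case
    by (rule exec_WhileE) (use WhileTrue.hyps WhileTrue.IH in fastforce)+
qed

text \<open>Argument and result are passed in register 0.\<close>

definition computable :: "(int \<Rightarrow> nat) \<Rightarrow> bool" where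
  "computable f \<longleftrightarrow> (\<exists>c. \<forall>x. \<exists>t s'.
     exec c \<lparr>reg = (\<lambda>_. 0)(0 := x), mem = (\<lambda>_. 0)\<rparr> t s' \<and> reg s' 0 = int (f x))"

text \<open>
  The machine gets the graph with vertex set \<open>{..<n}\<close> and edge set \<open>E\<close> as the row-major adjacency
  matrix in the cells \<open>0, \<dots>, n\<^sup>2 - 1\<close>, and \<open>n\<close>, \<open>k\<close>, \<open>p\<close> in the registers 0, 1, 2.
\<close>

definition cut_input :: "nat \<Rightarrow> nat set set \<Rightarrow> int \<Rightarrow> int \<Rightarrow> state" where
  "cut_input n E k p =
     \<lparr>reg = (\<lambda>_. 0)(0 := int n, 1 := k, 2 := p),
      mem = (\<lambda>a. if \<exists>i<n. \<exists>j<n. a = int (i * n + j) \<and> {i, j} \<in> E then 1 else 0)\<rparr>"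

definition cut_edges :: "'a set set \<Rightarrow> 'a set \<Rightarrow> 'a set set" where
  "cut_edges E V' = {e \<in> E. card (e \<inter> V') = 1}"

definition max_k_cut :: "'a set \<Rightarrow> 'a set set \<Rightarrow> int \<Rightarrow> int \<Rightarrow> bool" where
  "max_k_cut V E k p \<longleftrightarrow>
     (\<exists>V'\<subseteq>V. int (card V') = k \<and> int (card (cut_edges E V')) \<ge> p)"

end

theory Submission
  imports Defs "HOL-Library.Nat_Bijection"
begin

text \<open>
  Sort the vertices by decreasing degree and let \<open>T\<close> be the set of the first \<open>8p\<^sup>2\<close> of them. If some
  \<open>k\<close>-set has at least \<open>p\<close> cut edges, then so has one that consists of a subset of \<open>T\<close> and an
  initial segment of the remaining vertices, so that it suffices to try the subsets of \<open>T\<close>.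
  A vertex of degree \<open>3p\<close> can be made to have \<open>p\<close> cut edges. If all degrees are smaller and one side
  of the cut has less than \<open>p\<close> vertices, an exchange argument moves this side into \<open>T\<close>. If both sides
  have at least \<open>p\<close> vertices, then either all vertices outside \<open>T\<close> are isolated, or a matching of \<open>p\<close>
  edges that meet \<open>T\<close> can be cut.
\<close>

subsection \<open>Cuts and vertices of large degree\<close>

text \<open>The prescribed size \<open>k\<close> is the obstacle: once
  \<open>S \<subseteq> T\<close> is chosen, \<open>k - card S\<close> vertices outside
  \<open>T\<close> must be added, and there are too many ways to choose them. The candidates
  therefore fix which vertices are added for each number, and the structural theorem holds for any
  such choice \<open>F\<close>. It aims at the threshold \<open>p\<close>, not at an optimal cut:
  with a vertex of large degree, or with a matching, the given solution is forgotten except for its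
  size, and \<open>T\<close> alone has enough freedom to cut \<open>p\<close> edges whichever sides
  the outside vertices are on. Degree \<open>3 * p\<close> forces \<open>p\<close> neighbours into
  one of \<open>F\<close>, \<open>V - T - F\<close> and \<open>T\<close>. If all degrees are
  smaller, closed neighbourhoods have at most \<open>3 * p\<close> vertices; the matching uses at
  most two vertices of \<open>T\<close> per edge, so more than \<open>2 * p * (3 * p)\<close>
  vertices in \<open>T\<close> always leave one far from those used. The exchange needs half of
  that. The factor 8 exceeds 6 and is reached by doublings, which suits a machine without
  multiplication.\<close>

locale finite_graph =
  fixes V :: "'a set" and adj :: "'a \<Rightarrow> 'a \<Rightarrow> bool"
  assumes finite_V: "finite V"
    and adj_V: "adj u v \<Longrightarrow> u \<in> V \<and> v \<in> V"
    and adj_sym: "adj u v \<Longrightarrow> adj v u"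
    and adj_irrefl: "\<not> adj u u"
begin

definition nbhd :: "'a \<Rightarrow> 'a set" where
  "nbhd u = {v. adj u v}"

definition degree :: "'a \<Rightarrow> nat" where
  "degree u = card (nbhd u)"

text \<open>Pairs are oriented from inside to outside, so each cut edge is counted once although
  \<open>adj\<close> is symmetric.\<close>

definition cut :: "'a set \<Rightarrow> ('a \<times> 'a) set" where
  "cut S = {(u, v). u \<in> S \<and> v \<notin> S \<and> adj u v}"

lemma nbhd_subset: "nbhd u \<subseteq> V"
  using adj_V by (auto simp: nbhd_def)

lemma finite_nbhd: "finite (nbhd u)"
  using nbhd_subset finite_V finite_subset by blast

lemma finite_cut: "finite (cut S)"
proof (rule finite_subset)
  show "cut S \<subseteq> V \<times> V" using adj_V by (auto simp: cut_def)
qed (simp add: finite_V)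

lemma card_cut_complement: "card (cut (V - S)) = card (cut S)"
proof -
  have "cut (V - S) = (\<lambda>(u, v). (v, u)) ` cut S"
    using adj_V adj_sym by (auto simp: cut_def image_iff)
  then show ?thesis by (simp add: card_image inj_on_def split_beta prod_eq_iff)
qed

lemma card_cut_insert_le: "card (cut (insert v W)) \<le> card (cut W) + degree v"
proof -
  have "cut (insert v W) \<subseteq> cut W \<union> Pair v ` nbhd v"
    by (auto simp: cut_def nbhd_def)
  then have "card (cut (insert v W)) \<le> card (cut W \<union> Pair v ` nbhd v)"
    by (intro card_mono) (auto simp: finite_cut finite_nbhd)
  also have "\<dots> \<le> card (cut W) + card (Pair v ` nbhd v)" by (rule card_Un_le)
  also have "card (Pair v ` nbhd v) = degree v"
    unfolding degree_def by (rule card_image) (simp add: inj_on_def)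
  finally show ?thesis .
qed

text \<open>As \<open>u\<close> has no neighbour in \<open>W\<close>, moving it inside uncuts
  nothing, and all of its edges become cut.\<close>

lemma card_cut_insert_ge:
  assumes "u \<notin> W" and indep: "\<And>w. w \<in> W \<Longrightarrow> \<not> adj w u"
  shows "card (cut W) + degree u \<le> card (cut (insert u W))"
proof -
  have "card (cut W) + degree u = card (cut W) + card (Pair u ` nbhd u)"
    unfolding degree_def by (simp add: card_image inj_on_def)
  also have "\<dots> = card (cut W \<union> Pair u ` nbhd u)"
    by (rule card_Un_disjoint[symmetric, OF finite_cut])
      (use assms in \<open>auto simp: finite_nbhd cut_def\<close>)
  also have "\<dots> \<le> card (cut (insert u W))"
    by (rule card_mono[OF finite_cut])
      (use assms adj_irrefl adj_sym in \<open>auto simp: cut_def nbhd_def\<close>)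
  finally show ?thesis .
qed

text \<open>The strict degree bound absorbs the vertex itself: a closed neighbourhood has at most
  \<open>d\<close> elements.\<close>

lemma card_closed_nbhd_le:
  assumes "finite A" and "\<And>v. v \<in> A \<Longrightarrow> degree v < d"
  shows "card (A \<union> (\<Union>v\<in>A. nbhd v)) \<le> card A * d"
proof -
  have "card (A \<union> (\<Union>v\<in>A. nbhd v)) = card (\<Union>v\<in>A. insert v (nbhd v))"
    by (rule arg_cong[where f = card]) auto
  also have "\<dots> \<le> (\<Sum>v\<in>A. card (insert v (nbhd v)))"
    by (rule card_UN_le[OF assms(1)])
  also have "\<dots> \<le> (\<Sum>v\<in>A. d)"
  proof (rule sum_mono)
    fix v assume "v \<in> A"
    then show "card (insert v (nbhd v)) \<le> d"
      using assms(2)[of v] card_insert_le_m1[of d "nbhd v" v]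
      by (cases "d = 0") (auto simp: degree_def)
  qed
  finally show ?thesis by simp
qed

text \<open>The closed neighbourhood of \<open>A\<close> is too small to cover \<open>T\<close>.
  This drives both the exchange and the greedy matching.\<close>

lemma exists_far_vertex:
  assumes "finite A" and "\<And>v. v \<in> A \<Longrightarrow> degree v < d" and "card A * d < card T"
  obtains u where "u \<in> T" "u \<notin> A" "\<And>w. w \<in> A \<Longrightarrow> \<not> adj w u"
proof -
  have "\<not> T \<subseteq> A \<union> (\<Union>v\<in>A. nbhd v)"
  proof
    assume "T \<subseteq> A \<union> (\<Union>v\<in>A. nbhd v)"
    then have "card T \<le> card (A \<union> (\<Union>v\<in>A. nbhd v))"
      by (rule card_mono[rotated]) (simp add: assms(1) finite_nbhd)
    with card_closed_nbhd_le[OF assms(1,2)] assms(3) show False by fastforce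
  qed
  then show ?thesis using that by (auto simp: nbhd_def)
qed

text \<open>Exchange argument: a vertex outside \<open>T\<close> is replaced by one of \<open>T\<close> that has at least the same
  degree and no neighbour in the solution.\<close>

lemma exchange_into_top:
  assumes "W \<subseteq> V" "T \<subseteq> V" and deg: "\<And>v. v \<in> V \<Longrightarrow> degree v < d"
    and top: "\<And>u v. u \<in> T \<Longrightarrow> v \<in> V - T \<Longrightarrow> degree v \<le> degree u"
    and large: "card W * d < card T"
  shows "\<exists>S\<subseteq>T. card S = card W \<and> card (cut W) \<le> card (cut S)"
  using assms(1) large
proof (induction "card (W - T)" arbitrary: W)
  case 0
  have "finite (W - T)" using 0(2) finite_V finite_subset by auto
  with 0 have "W \<subseteq> T" by auto
  then show ?case by blast
next
  case (Suc x)
  have finW: "finite W" using Suc.prems(1) finite_V finite_subset by auto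
  obtain v where v: "v \<in> W" "v \<notin> T"
    using Suc.hyps(2) by (metis Diff_eq_empty_iff card.empty nat.distinct(1) subsetI)
  obtain u where u: "u \<in> T" "u \<notin> W" "\<And>w. w \<in> W \<Longrightarrow> \<not> adj w u"
    using exists_far_vertex[OF finW _ Suc.prems(2)] deg Suc.prems(1) by blast
  define W' where "W' = insert u (W - {v})"
  have card_W': "card W' = card W"
    using u(2) v(1) finW unfolding W'_def by (simp add: card_Suc_Diff1 del: card_Diff_insert card_Diff_singleton)
  have "W' - T = (W - T) - {v}" using u(1) by (auto simp: W'_def)
  then have "card (W' - T) = x" using Suc.hyps(2) v finW by simp
  then obtain S where S: "S \<subseteq> T" "card S = card W'" "card (cut W') \<le> card (cut S)"
    using Suc.hyps(1)[of W'] Suc.prems u(1) assms(2) card_W' by (auto simp: W'_def)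
  \<comment> \<open>Both estimates pass through \<open>W - {v}\<close>: dropping \<open>v\<close>
    loses at most \<open>degree v\<close>, and adding \<open>u\<close> gains at least
    \<open>degree u\<close>.\<close>
  have "card (cut W) \<le> card (cut (W - {v})) + degree v"
    using card_cut_insert_le[of v "W - {v}"] v(1) by (simp add: insert_absorb)
  also have "\<dots> \<le> card (cut (W - {v})) + degree u"
    using top[OF u(1), of v] v Suc.prems(1) by auto
  also have "\<dots> \<le> card (cut W')"
    unfolding W'_def by (rule card_cut_insert_ge) (use u in auto)
  finally show ?case using S card_W' by auto
qed

text \<open>The edges from \<open>A\<close> to \<open>B\<close> are cut by every set that contains \<open>A\<close> and avoids \<open>B\<close>.\<close>

definition edges_between :: "'a set \<Rightarrow> 'a set \<Rightarrow> ('a \<times> 'a) set" where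
  "edges_between A B = {(u, v). u \<in> A \<and> v \<in> B \<and> adj u v}"

lemma finite_edges_between: "finite (edges_between A B)"
  by (rule finite_subset[of _ "V \<times> V"]) (use adj_V finite_V in \<open>auto simp: edges_between_def\<close>)

text \<open>The vertices of \<open>T\<close> outside \<open>A\<close> and \<open>B\<close> are
  filler for reaching size \<open>s\<close>. They cannot uncut the counted edges, whose endpoints
  already have their sides through \<open>A\<close>, \<open>B\<close> and \<open>F\<close>.\<close>

lemma exists_cut_of_size:
  assumes "T \<subseteq> V" "F \<subseteq> V - T" "A \<subseteq> T" "B \<subseteq> T" "A \<inter> B = {}"
    and "card A \<le> s" "s + card B \<le> card T"
    and p: "p \<le> card (edges_between (A \<union> F) (B \<union> (V - T - F)))"
  shows "\<exists>S\<subseteq>T. card S = s \<and> p \<le> card (cut (S \<union> F))"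
proof -
  have finT: "finite T" using assms(1) finite_V finite_subset by blast
  then have "card (T - B) = card T - card B"
    using assms(4) finite_subset by (intro card_Diff_subset) auto
  then obtain S where S: "A \<subseteq> S" "S \<subseteq> T - B" "card S = s"
    using exists_subset_between[of A s "T - B"] assms finT by fastforce
  have "edges_between (A \<union> F) (B \<union> (V - T - F)) \<subseteq> cut (S \<union> F)"
    using S assms by (auto simp: edges_between_def cut_def)
  then have "p \<le> card (cut (S \<union> F))"
    using p card_mono[OF finite_cut] by (meson order_trans)
  then show ?thesis using S by blast
qed

text \<open>By pigeonhole \<open>p\<close> neighbours of \<open>v\<close> lie in \<open>F\<close>,
  in \<open>V - T - F\<close> or in \<open>T\<close>. In the first two cases they are all on one
  known side and \<open>v\<close> goes to the other.\<close>

lemma cut_at_high_degree_vertex: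
  assumes "T \<subseteq> V" "F \<subseteq> V - T" "v \<in> T" "3 * p \<le> degree v"
    and s: "1 \<le> s" "s < card T" and large: "2 * p \<le> card T"
  shows "\<exists>S\<subseteq>T. card S = s \<and> p \<le> card (cut (S \<union> F))"
proof -
  have from_v: "p \<le> card (edges_between A B)" if "v \<in> A" "N \<subseteq> nbhd v" "N \<subseteq> B" "p \<le> card N" for A B N
  proof -
    have "Pair v ` N \<subseteq> edges_between A B" using that by (auto simp: edges_between_def nbhd_def)
    then have "card (Pair v ` N) \<le> card (edges_between A B)"
      by (rule card_mono[OF finite_edges_between])
    with that(4) show ?thesis by (simp add: card_image inj_on_def)
  qed
  have to_v: "p \<le> card (edges_between A B)" if "v \<in> B" "N \<subseteq> nbhd v" "N \<subseteq> A" "p \<le> card N" for A B N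
  proof -
    have "(\<lambda>u. (u, v)) ` N \<subseteq> edges_between A B"
      using that adj_sym by (auto simp: edges_between_def nbhd_def)
    then have "card ((\<lambda>u. (u, v)) ` N) \<le> card (edges_between A B)"
      by (rule card_mono[OF finite_edges_between])
    with that(4) show ?thesis by (simp add: card_image inj_on_def)
  qed
  have "nbhd v = (nbhd v \<inter> F) \<union> (nbhd v \<inter> (V - T - F)) \<union> (nbhd v \<inter> T)"
    using nbhd_subset by auto
  then have "degree v \<le> card (nbhd v \<inter> F) + card (nbhd v \<inter> (V - T - F)) + card (nbhd v \<inter> T)"
    unfolding degree_def by (metis (no_types, lifting) add_le_mono1 card_Un_le order_trans)
  then consider "p \<le> card (nbhd v \<inter> F)" | "p \<le> card (nbhd v \<inter> (V - T - F))"
    | "p \<le> card (nbhd v \<inter> T)" using assms(4) by linarith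
  then show ?thesis
  proof cases
    case 1
    show ?thesis
      by (rule exists_cut_of_size[OF assms(1,2), of "{}" "{v}"])
        (use assms to_v[OF _ _ _ 1] in auto)
  next
    case 2
    show ?thesis
      by (rule exists_cut_of_size[OF assms(1,2), of "{v}" "{}"])
        (use assms from_v[OF _ _ _ 2] in auto)
  next
    case 3
    then obtain N where N: "N \<subseteq> nbhd v \<inter> T" "card N = p"
      using obtain_subset_with_card_n by metis
    have "v \<notin> N" using N adj_irrefl by (auto simp: nbhd_def)
    show ?thesis
    \<comment> \<open>Neighbours in \<open>T\<close> can be placed freely, but the size
      \<open>s\<close> decides how: if \<open>S\<close> has room for \<open>p\<close> of them, they
      go in and \<open>v\<close> stays out; otherwise \<open>v\<close> goes in and they stay out,
      which fits because \<open>s + p < 2 * p \<le> card T\<close>.\<close>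
    proof (cases "p \<le> s")
      case True
      show ?thesis
        by (rule exists_cut_of_size[OF assms(1,2), of N "{v}"])
          (use assms True N \<open>v \<notin> N\<close> to_v[of _ N] in auto)
    next
      case False
      show ?thesis
        by (rule exists_cut_of_size[OF assms(1,2), of "{v}" N])
          (use assms False N \<open>v \<notin> N\<close> from_v[of _ N] in auto)
    qed
  qed
qed

text \<open>A greedily built matching, each edge of which is made a cut edge by the side chosen
  for its endpoints in \<open>T\<close>; those outside \<open>T\<close> have a fixed side.\<close>

lemma greedy_matching:
  assumes "T \<subseteq> V" "F \<subseteq> V - T" and deg: "\<And>v. v \<in> V \<Longrightarrow> degree v < d"
    and pos: "\<And>v. v \<in> T \<Longrightarrow> 0 < degree v"
    and large: "2 * p * d < card T"
  shows "\<exists>A B. A \<subseteq> T \<and> B \<subseteq> T \<and> A \<inter> B = {} \<and> card A \<le> p \<and> card B \<le> p \<and>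
    p \<le> card (edges_between (A \<union> F) (B \<union> (V - T - F)))"
  using large
proof (induction p)
  case 0
  show ?case by (intro exI[of _ "{}"]) simp
next
  case (Suc p)
  have "2 * p * d \<le> 2 * Suc p * d" by simp
  then obtain A B where AB: "A \<subseteq> T" "B \<subseteq> T" "A \<inter> B = {}" "card A \<le> p" "card B \<le> p"
    "p \<le> card (edges_between (A \<union> F) (B \<union> (V - T - F)))"
    using Suc by (meson le_less_trans)
  have finT: "finite T" using assms(1) finite_V finite_subset by blast
  have fin: "finite A" "finite B" using AB finT by (auto dest: finite_subset)
  have "card (A \<union> B) \<le> 2 * p" using card_Un_le[of A B] AB by linarith
  then have "card (A \<union> B) * d \<le> 2 * p * d" by (rule mult_le_mono1)
  then have "card (A \<union> B) * d < card T" using \<open>2 * p * d \<le> 2 * Suc p * d\<close> Suc.prems by linarith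
  then obtain x where x: "x \<in> T" "x \<notin> A \<union> B" "\<And>w. w \<in> A \<union> B \<Longrightarrow> \<not> adj w x"
    using exists_far_vertex[of "A \<union> B" d T] deg AB assms(1) fin by blast
  obtain y where y: "adj x y"
    using pos[OF x(1)] by (auto simp: degree_def nbhd_def card_gt_0_iff)
  \<comment> \<open>The neighbour \<open>y\<close> is not in \<open>A \<union> B\<close> because
    \<open>x\<close> has no neighbour there. So if \<open>y\<close> lies in \<open>T\<close>, its
    side is still free.\<close>
  have y': "y \<in> V" "y \<notin> A \<union> B" "y \<noteq> x" "adj y x"
    using x(3) y adj_sym adj_V adj_irrefl by blast+
  have grow: ?case if A': "A \<subseteq> A'" "A' \<subseteq> T" "card A' \<le> Suc p" and B': "B \<subseteq> B'" "B' \<subseteq> T" "card B' \<le> Suc p"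
    and disj: "A' \<inter> B' = {}"
    and e: "e \<in> edges_between (A' \<union> F) (B' \<union> (V - T - F))" "x = fst e \<or> x = snd e" for A' B' e
  proof -
    \<comment> \<open>Newness comes from the endpoint \<open>x\<close> in \<open>T\<close> alone; an
      endpoint outside \<open>T\<close> may serve several edges.\<close>
    have new: "e \<notin> edges_between (A \<union> F) (B \<union> (V - T - F))"
      using e(2) x assms(2) by (auto simp: edges_between_def)
    have "insert e (edges_between (A \<union> F) (B \<union> (V - T - F))) \<subseteq> edges_between (A' \<union> F) (B' \<union> (V - T - F))"
      using A' B' e by (auto simp: edges_between_def)
    then have "card (insert e (edges_between (A \<union> F) (B \<union> (V - T - F)))) \<le> card (edges_between (A' \<union> F) (B' \<union> (V - T - F)))"
      by (rule card_mono[OF finite_edges_between])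
    then have "Suc p \<le> card (edges_between (A' \<union> F) (B' \<union> (V - T - F)))"
      using AB(6) new by (simp add: finite_edges_between)
    then show ?thesis using A' B' disj by blast
  qed
  have card_ins: "card (insert z A) \<le> Suc p" "card (insert z B) \<le> Suc p" for z
    using AB(4,5) fin by (auto simp: card_insert_if)
  have le: "card A \<le> Suc p" "card B \<le> Suc p" using AB by auto
  consider "y \<in> F" | "y \<in> T" | "y \<in> V - T - F" using y' by auto
  then show ?case
  proof cases
    case 1
    show ?thesis
      by (rule grow[of A "insert x B" "(y, x)"])
        (use 1 AB x y y' card_ins le in \<open>auto simp: edges_between_def\<close>)
  next
    case 2
    show ?thesis
      by (rule grow[of "insert x A" "insert y B" "(x, y)"])
        (use 2 AB x y y' card_ins in \<open>auto simp: edges_between_def\<close>)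
  next
    case 3
    show ?thesis
      by (rule grow[of "insert x A" B "(x, y)"])
        (use 3 AB x y y' card_ins le in \<open>auto simp: edges_between_def\<close>)
  qed
qed

text \<open>Only the sizes of the sets \<open>F m\<close> enter. In each case either none or all of
  the vertices outside \<open>T\<close> are taken, or they are isolated, or the cut is built to work
  with whatever sides \<open>F\<close> assigns to them.\<close>

theorem cut_from_top_degrees:
  assumes T: "T \<subseteq> V"
    and top: "\<And>u v. u \<in> T \<Longrightarrow> v \<in> V - T \<Longrightarrow> degree v \<le> degree u"
    and large: "8 * p * p \<le> card T"
    and F: "\<And>m. m \<le> card (V - T) \<Longrightarrow> F m \<subseteq> V - T \<and> card (F m) = m"
    and W: "W \<subseteq> V" "0 < p" "p \<le> card (cut W)"
  shows "\<exists>S m. S \<subseteq> T \<and> m \<le> card (V - T) \<and> card S + m = card W \<and> p \<le> card (cut (S \<union> F m))"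
proof -
  define k n g where "k = card W" and "n = card V" and "g = card T"
  have finT: "finite T" and finW: "finite W" using T W finite_V finite_subset by blast+
  have gn: "g \<le> n" unfolding g_def n_def using T finite_V by (rule card_mono[rotated])
  have card_VT: "card (V - T) = n - g" unfolding n_def g_def using T finT by (simp add: card_Diff_subset)
  have pp: "p \<le> p * p" by simp
  have large: "8 * (p * p) \<le> g" using large by (simp add: g_def mult.assoc)
  have g8: "8 * p \<le> g" using large pp by linarith
  have size: "\<exists>S m. S \<subseteq> T \<and> m \<le> card (V - T) \<and> card S + m = card W \<and> p \<le> card (cut (S \<union> F m))"
    if "\<exists>S\<subseteq>T. card S = s \<and> p \<le> card (cut (S \<union> F (k - s)))" "s \<le> k" "k - s \<le> n - g" for s
    using that card_VT by (metis k_def le_add_diff_inverse)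
  have "cut W \<noteq> {}" using W by auto
  then obtain a b where ab: "a \<in> W" "b \<in> V - W" using adj_V unfolding cut_def by blast
  then have "W \<subset> V" using W by auto
  then have kn: "0 < k" "k < n" unfolding k_def n_def
    using ab finW by (auto simp: card_gt_0_iff finite_V psubset_card_mono)
  show ?thesis
  proof (cases "\<exists>v\<in>V. 3 * p \<le> degree v")
    case True
    have "T \<noteq> {}" using large pp W(2) by (auto simp: g_def)
    then obtain v where v: "v \<in> T" "3 * p \<le> degree v"
      using True top by (metis DiffI all_not_in_conv order_trans)
    \<comment> \<open>At least \<open>k + g - n\<close> vertices must come from \<open>T\<close>,
      since \<open>V - T\<close> offers only \<open>n - g\<close> (the subtraction truncates at 0).
      The maximum with 1 allows \<open>v\<close> to be put inside, and \<open>k < n\<close> leaves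
      room to put it outside.\<close>
    define s where "s = max 1 (k + g - n)"
    have s: "1 \<le> s" "s < g" "s \<le> k" "k - s \<le> n - g"
      using kn gn g8 W(2) by (auto simp: s_def)
    have "\<exists>S\<subseteq>T. card S = s \<and> p \<le> card (cut (S \<union> F (k - s)))"
      by (rule cut_at_high_degree_vertex[OF T _ v])
        (use s F card_VT g8 in \<open>auto simp: g_def\<close>)
    then show ?thesis using s by (intro size)
  next
    case False
    then have deg: "degree v < 3 * p" if "v \<in> V" for v using that by force
    have small: "x * (3 * p) < g" if "x < p" for x
    proof -
      have "x * p \<le> p * p" using that by (intro mult_le_mono1) simp
      moreover have "x * (3 * p) = 3 * (x * p)" by simp
      ultimately show ?thesis using large pp W(2) by linarith
    qed
    consider "k < p" | "n - k < p" | "p \<le> k" "p \<le> n - k" by linarith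
    then show ?thesis
    proof cases
      case 1
      then obtain S where "S \<subseteq> T" "card S = card W" "card (cut W) \<le> card (cut S)"
        using exchange_into_top[OF W(1) T deg top] small[OF 1] by (auto simp: g_def k_def)
      moreover have "F 0 = {}" using F[of 0] finite_V finite_subset by fastforce
      ultimately show ?thesis using W(3) by (intro exI[of _ S] exI[of _ 0]) simp
    next
      case 2
      \<comment> \<open>The small side is now the complement, which has the same cut. The exchange
        moves it into \<open>T\<close>, so the solution contains all of \<open>V - T\<close>, that
        is, \<open>m = n - g\<close>.\<close>
      have cVW: "card (V - W) = n - k" unfolding n_def k_def using W(1) finW by (simp add: card_Diff_subset)
      then obtain S where S: "S \<subseteq> T" "card S = n - k" "card (cut (V - W)) \<le> card (cut S)"
        using exchange_into_top[of "V - W", OF _ T deg top] small[OF 2] by (auto simp: g_def)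
      have F': "F (n - g) = V - T"
        by (rule card_subset_eq) (use F card_VT finite_V in auto)
      have "(T - S) \<union> F (n - g) = V - S" using S(1) T F' by auto
      then have "p \<le> card (cut ((T - S) \<union> F (n - g)))"
        using S(3) W(3) by (simp add: card_cut_complement)
      moreover have "card (T - S) + (n - g) = k"
      proof -
        have "card (T - S) = g - (n - k)"
          using S finT finite_subset[OF S(1) finT] by (simp add: card_Diff_subset g_def)
        moreover have "n - k \<le> g" using S finT card_mono by (metis g_def)
        ultimately show ?thesis using kn gn by simp
      qed
      ultimately show ?thesis using card_VT by (intro exI[of _ "T - S"] exI[of _ "n - g"]) (auto simp: k_def)
    next
      case 3
      show ?thesis
      proof (cases "\<exists>v\<in>T. degree v = 0")
        case True
        \<comment> \<open>The degree order passes degree 0 from a vertex of \<open>T\<close> to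
          every vertex outside. All edges then lie within \<open>T\<close>, and any \<open>m\<close>
          outside vertices can replace \<open>W - T\<close>.\<close>
        have iso: "\<not> adj u v" if "u \<in> V - T" for u v
        proof -
          have "degree u = 0" using True top that by fastforce
          then show ?thesis using finite_nbhd[of u] by (auto simp: degree_def nbhd_def)
        qed
        have both: "u \<in> T \<and> v \<in> T" if "adj u v" for u v
          using that iso adj_sym adj_V by blast
        define m where "m = card (W - T)"
        have m: "m \<le> card (V - T)" unfolding m_def using W(1) finite_V by (intro card_mono) auto
        have "cut ((W \<inter> T) \<union> F m) = cut W"
          using both F[OF m] by (auto simp: cut_def)
        moreover have "card (W \<inter> T) + m = card W"
          unfolding m_def using finW by (metis card_Int_Diff)
        ultimately show ?thesis using m W(3) by (intro exI[of _ "W \<inter> T"] exI[of _ m]) auto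
      next
        case False
        \<comment> \<open>As in the case of large degree, but with room for \<open>p\<close>
          vertices of \<open>T\<close> on either side: \<open>s + p \<le> g\<close> follows from
          \<open>p \<le> n - k\<close> and \<open>8 * p \<le> g\<close>.\<close>
        define s where "s = max p (k + g - n)"
        have s: "p \<le> s" "s + p \<le> g" "s \<le> k" "k - s \<le> n - g"
          using kn gn 3 g8 by (auto simp: s_def)
        have Fs: "F (k - s) \<subseteq> V - T" using F s card_VT by simp
        have "2 * p * (3 * p) = 6 * (p * p)" by simp
        then have "2 * p * (3 * p) < card T" using large pp W(2) unfolding g_def by linarith
        then obtain A B where "A \<subseteq> T" "B \<subseteq> T" "A \<inter> B = {}" "card A \<le> p" "card B \<le> p"
          "p \<le> card (edges_between (A \<union> F (k - s)) (B \<union> (V - T - F (k - s))))"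
          using greedy_matching[OF T Fs deg, of p] False by auto
        then have "\<exists>S\<subseteq>T. card S = s \<and> p \<le> card (cut (S \<union> F (k - s)))"
          using s by (intro exists_cut_of_size[OF T Fs]) (auto simp: g_def)
        then show ?thesis using s by (intro size)
      qed
    qed
  qed
qed

end

subsection \<open>Running time of programs\<close>

text \<open>Total correctness with an upper time bound; as \<open>exec\<close> is deterministic, the
  run that exists is the only one.\<close>

definition runs :: "com \<Rightarrow> state \<Rightarrow> nat \<Rightarrow> (state \<Rightarrow> bool) \<Rightarrow> bool" where
  "runs c s T Q \<longleftrightarrow> (\<exists>t s'. exec c s t s' \<and> t \<le> T \<and> Q s')"

lemma runs_mono:
  assumes "runs c s T Q" "T \<le> T'" "\<And>s'. Q s' \<Longrightarrow> Q' s'"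
  shows "runs c s T' Q'"
  using assms unfolding runs_def by (meson order_trans)

lemma runs_Seq:
  assumes "runs c s T P" "\<And>s'. P s' \<Longrightarrow> runs d s' T' Q" "T + T' \<le> T''"
  shows "runs (Seq c d) s T'' Q"
proof -
  obtain t s' where 1: "exec c s t s'" "t \<le> T" "P s'" using assms(1) by (auto simp: runs_def)
  obtain t' s'' where 2: "exec d s' t' s''" "t' \<le> T'" "Q s''"
    using assms(2)[OF 1(3)] by (auto simp: runs_def)
  have "exec (Seq c d) s (t + t') s''" using 1 2 exec.Seq by blast
  moreover have "t + t' \<le> T''" using 1 2 assms(3) by simp
  ultimately show ?thesis using 2 by (auto simp: runs_def)
qed

primrec loop_free :: "com \<Rightarrow> bool" where
  "loop_free Skip \<longleftrightarrow> True"
| "loop_free (Assign x a) \<longleftrightarrow> True"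
| "loop_free (Store a b) \<longleftrightarrow> True"
| "loop_free (Seq c d) \<longleftrightarrow> loop_free c \<and> loop_free d"
| "loop_free (Cond b c d) \<longleftrightarrow> loop_free c \<and> loop_free d"
| "loop_free (While b c) \<longleftrightarrow> False"

text \<open>The values at loops are irrelevant.\<close>

primrec effect :: "com \<Rightarrow> state \<Rightarrow> state" where
  "effect Skip s = s"
| "effect (Assign x a) s = s\<lparr>reg := (reg s)(x := aval a s)\<rparr>"
| "effect (Store a b) s = s\<lparr>mem := (mem s)(aval a s := aval b s)\<rparr>"
| "effect (Seq c d) s = effect d (effect c s)"
| "effect (Cond b c d) s = (if bval b s then effect c s else effect d s)"
| "effect (While b c) s = s"

primrec cost :: "com \<Rightarrow> nat" where
  "cost Skip = 1"
| "cost (Assign x a) = 1"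
| "cost (Store a b) = 1"
| "cost (Seq c d) = cost c + cost d"
| "cost (Cond b c d) = max (cost c) (cost d) + 1"
| "cost (While b c) = 0"

lemma exec_loop_free:
  "loop_free c \<Longrightarrow> \<exists>t\<le>cost c. exec c s t (effect c s)"
proof (induction c arbitrary: s)
  case (Seq c d)
  then obtain t t' where "t \<le> cost c" "exec c s t (effect c s)"
    "t' \<le> cost d" "exec d (effect c s) t' (effect d (effect c s))"
    by (metis loop_free.simps(4))
  then show ?case by (intro exI[of _ "t + t'"]) (auto intro: exec.Seq)
next
  case (Cond b c d)
  then obtain t t' where t: "t \<le> cost c" "exec c s t (effect c s)"
    "t' \<le> cost d" "exec d s t' (effect d s)"
    by (metis loop_free.simps(5))
  show ?case
  proof (cases "bval b s")
    case True
    then show ?thesis using t by (intro exI[of _ "t + 1"]) (auto intro: exec.CondTrue[simplified])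
  next
    case False
    then show ?thesis using t by (intro exI[of _ "t' + 1"]) (auto intro: exec.CondFalse[simplified])
  qed
qed (auto intro: exec.intros[simplified])

text \<open>Reduces loop-free code to symbolic evaluation by the simplifier, so that invariants are
  needed at loops only.\<close>

lemma runs_loop_free:
  assumes "loop_free c" "Q (effect c s)" "cost c \<le> T"
  shows "runs c s T Q"
  using exec_loop_free[OF assms(1), of s] assms unfolding runs_def by (meson order_trans)

lemma runs_While:
  assumes init: "I 0 s"
    and step: "\<And>i s. i < N \<Longrightarrow> I i s \<Longrightarrow> bval b s \<and> runs c s B (I (Suc i))"
    and final: "\<And>s. I N s \<Longrightarrow> \<not> bval b s \<and> Q s"
    and time: "N * (B + 1) + 1 \<le> T"
  shows "runs (While b c) s T Q"
proof -
  \<comment> \<open>Here \<open>i\<close> counts the iterations still to come, so that the induction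
    follows \<open>WhileTrue\<close> from the front of the run.\<close>
  have "i \<le> N \<Longrightarrow> I (N - i) s \<Longrightarrow> runs (While b c) s (i * (B + 1) + 1) Q" for i s
  proof (induction i arbitrary: s)
    case 0
    then show ?case using final[of s] exec.WhileFalse[of b s c] by (auto simp: runs_def)
  next
    case (Suc i)
    then have "bval b s \<and> runs c s B (I (Suc (N - Suc i)))"
      by (intro step) auto
    moreover have "Suc (N - Suc i) = N - i" using Suc.prems(1) by simp
    ultimately obtain t s' where t: "bval b s" "exec c s t s'" "t \<le> B" "I (N - i) s'"
      by (auto simp: runs_def)
    obtain t' s'' where t': "exec (While b c) s' t' s''" "t' \<le> i * (B + 1) + 1" "Q s''"
      using Suc.IH[OF _ t(4)] Suc.prems(1) by (auto simp: runs_def)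
    have "exec (While b c) s (t + t' + 1) s''"
      using t t' exec.WhileTrue by blast
    moreover have "t + t' + 1 \<le> Suc i * (B + 1) + 1" using t t' by simp
    ultimately show ?case using t'(3) unfolding runs_def by blast
  qed
  from this[of N s] init show ?thesis using runs_mono[OF _ time] by simp
qed

definition For :: "nat \<Rightarrow> aexp \<Rightarrow> com \<Rightarrow> com" where
  "For x e c = Seq (Assign x (Const 0))
     (While (Less (Reg x) e) (Seq c (Assign x (Plus (Reg x) (Const 1)))))"

text \<open>The limit \<open>e\<close> is evaluated anew at each test, hence the hypothesis on all
  invariant states. Each round adds 2 steps for test and increment; the final 2 are the
  initialisation and the failing test.\<close>

lemma runs_For:
  assumes init: "I 0 (s\<lparr>reg := (reg s)(x := 0)\<rparr>)"
    and step: "\<And>i s. i < N \<Longrightarrow> I i s \<Longrightarrow> reg s x = int i \<Longrightarrow>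
      runs c s B (\<lambda>s'. reg s' x = int i \<and> I (Suc i) (s'\<lparr>reg := (reg s')(x := int (Suc i))\<rparr>))"
    and limit: "\<And>i s. I i s \<Longrightarrow> reg s x = int i \<Longrightarrow> int i < aval e s \<longleftrightarrow> i < N"
    and final: "\<And>s. I N s \<Longrightarrow> reg s x = int N \<Longrightarrow> Q s"
    and time: "N * (B + 2) + 2 \<le> T"
  shows "runs (For x e c) s T Q"
  unfolding For_def
proof (rule runs_Seq)
  let ?J = "\<lambda>i s. I i s \<and> reg s x = int i"
  show "runs (Assign x (Const 0)) s 1 (?J 0)"
    by (rule runs_loop_free) (use init in auto)
  show "1 + (N * (B + 2) + 1) \<le> T" using time by simp
  fix s assume J: "?J 0 s"
  show "runs (While (Less (Reg x) e) (Seq c (Assign x (Plus (Reg x) (Const 1))))) s (N * (B + 2) + 1) Q"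
  proof (rule runs_While[where I = ?J and B = "B + 1" and N = N])
    fix i s assume i: "i < N" "?J i s"
    have "runs (Seq c (Assign x (Plus (Reg x) (Const 1)))) s (B + 1) (?J (Suc i))"
    proof (rule runs_Seq)
      show "runs c s B (\<lambda>s'. reg s' x = int i \<and> I (Suc i) (s'\<lparr>reg := (reg s')(x := int (Suc i))\<rparr>))"
        using i step by blast
      show "runs (Assign x (Plus (Reg x) (Const 1))) s' 1 (?J (Suc i))"
        if "reg s' x = int i \<and> I (Suc i) (s'\<lparr>reg := (reg s')(x := int (Suc i))\<rparr>)" for s'
        by (rule runs_loop_free) (use that in \<open>auto simp: add.commute\<close>)
    qed simp
    then show "bval (Less (Reg x) e) s \<and> runs (Seq c (Assign x (Plus (Reg x) (Const 1)))) s (B + 1) (?J (Suc i))"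
      using limit i by auto
  qed (use J limit[of N] final in auto)
qed

definition count :: "(nat \<Rightarrow> bool) \<Rightarrow> nat \<Rightarrow> nat" where
  "count P n = card {i. i < n \<and> P i}"

lemma count_0 [simp]: "count P 0 = 0"
  by (simp add: count_def)

lemma count_Suc [simp]: "count P (Suc n) = count P n + of_bool (P n)"
proof -
  have "{i. i < Suc n \<and> P i} = (if P n then insert n {i. i < n \<and> P i} else {i. i < n \<and> P i})"
    by (auto simp: less_Suc_eq)
  then show ?thesis by (simp add: count_def)
qed

subsection \<open>The algorithm\<close>

text \<open>Registers 0, 1, 2 hold \<open>n\<close>, \<open>k\<close>, \<open>p\<close> and register 3 the number of top vertices. Registers
  4 and 5 are loop counters, 6 is an address in the adjacency matrix, 7 and 8 are accumulators,
  9 is the carry of the binary counter, and 10 the result. The cells \<open>-1 - i\<close>, \<open>-1 - n - u\<close> and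
  \<open>-1 - 2n - u\<close> hold whether the vertex of rank \<open>i\<close> is chosen, the rank of \<open>u\<close> and the degree of \<open>u\<close>.\<close>

definition bit_at :: "aexp \<Rightarrow> aexp" where "bit_at a = Minus (Const (-1)) a"
definition rank_at :: "aexp \<Rightarrow> aexp" where "rank_at a = Minus (bit_at a) (Reg 0)"
definition deg_at :: "aexp \<Rightarrow> aexp" where "deg_at a = Minus (rank_at a) (Reg 0)"

lemmas at_defs = bit_at_def rank_at_def deg_at_def

section \<open>Computing the kernel size and the degree order\<close>

text \<open>Without multiplication, \<open>8 * p\<close> is added \<open>p\<close> times. For
  negative \<open>p\<close> the loop is not entered, in agreement with \<open>nat p\<close>.\<close>

definition bound_prog :: com where
  "bound_prog = Seq (Assign 3 (Const 0))
     (For 4 (Reg 2) (Seq (Assign 5 (Plus (Reg 2) (Reg 2))) (Seq (Assign 5 (Plus (Reg 5) (Reg 5)))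
       (Assign 3 (Plus (Reg 3) (Plus (Reg 5) (Reg 5)))))))"

definition bound :: "int \<Rightarrow> nat" where
  "bound p = 8 * nat p * nat p"

lemma runs_bound_prog:
  "runs bound_prog s (5 * nat (reg s 2) + 3)
     (\<lambda>s'. mem s' = mem s \<and> (\<forall>x. x \<notin> {3, 4, 5} \<longrightarrow> reg s' x = reg s x) \<and> reg s' 3 = int (bound (reg s 2)))"
  unfolding bound_prog_def
proof (rule runs_Seq)
  show "runs (Assign 3 (Const 0)) s 1 (\<lambda>s'. s' = s\<lparr>reg := (reg s)(3 := 0)\<rparr>)"
    by (rule runs_loop_free) auto
  fix s' assume s': "s' = s\<lparr>reg := (reg s)(3 := 0)\<rparr>"
  show "runs (For 4 (Reg 2) (Seq (Assign 5 (Plus (Reg 2) (Reg 2))) (Seq (Assign 5 (Plus (Reg 5) (Reg 5)))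
       (Assign 3 (Plus (Reg 3) (Plus (Reg 5) (Reg 5))))))) s' (5 * nat (reg s 2) + 2)
     (\<lambda>s'. mem s' = mem s \<and> (\<forall>x. x \<notin> {3, 4, 5} \<longrightarrow> reg s' x = reg s x) \<and> reg s' 3 = int (bound (reg s 2)))"
    (is "runs _ _ _ ?Q")
  proof (rule runs_For[where N = "nat (reg s 2)" and B = 3 and
        I = "\<lambda>i s'. mem s' = mem s \<and> (\<forall>x. x \<notin> {3, 4, 5} \<longrightarrow> reg s' x = reg s x) \<and>
          reg s' 3 = 8 * (int i * reg s 2)"])
    fix t :: state assume "mem t = mem s \<and> (\<forall>x. x \<notin> {3, 4, 5} \<longrightarrow> reg t x = reg s x) \<and>
          reg t 3 = 8 * (int (nat (reg s 2)) * reg s 2)"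
    then show "?Q t" by (auto simp: bound_def nat_mult_distrib)
  next
    fix i and t :: state assume "mem t = mem s \<and> (\<forall>x. x \<notin> {3, 4, 5} \<longrightarrow> reg t x = reg s x) \<and>
          reg t 3 = 8 * (int i * reg s 2)" "reg t 4 = int i"
    then show "runs (Seq (Assign 5 (Plus (Reg 2) (Reg 2))) (Seq (Assign 5 (Plus (Reg 5) (Reg 5)))
       (Assign 3 (Plus (Reg 3) (Plus (Reg 5) (Reg 5)))))) t 3 (\<lambda>s'. reg s' 4 = int i \<and>
         mem (s'\<lparr>reg := (reg s')(4 := int (Suc i))\<rparr>) = mem s \<and>
         (\<forall>x. x \<notin> {3, 4, 5} \<longrightarrow> reg (s'\<lparr>reg := (reg s')(4 := int (Suc i))\<rparr>) x = reg s x) \<and>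
         reg (s'\<lparr>reg := (reg s')(4 := int (Suc i))\<rparr>) 3 = 8 * (int (Suc i) * reg s 2))"
      by (intro runs_loop_free) (auto simp: algebra_simps)
  qed (auto simp: s')
qed simp

text \<open>Register 6 is never reset between rows: it sweeps the row-major matrix once, so no
  address has to be computed by multiplication.\<close>

definition deg_prog :: com where
  "deg_prog = Seq (Assign 6 (Const 0)) (For 4 (Reg 0)
     (Seq (Assign 7 (Const 0))
     (Seq (For 5 (Reg 0) (Seq (Assign 7 (Plus (Reg 7) (Load (Reg 6)))) (Assign 6 (Plus (Reg 6) (Const 1)))))
       (Store (deg_at (Reg 4)) (Reg 7)))))"

lemma runs_deg_prog:
  assumes n: "reg s 0 = int n"
    and adj: "\<And>u v. u < n \<Longrightarrow> v < n \<Longrightarrow> mem s (int (u * n + v)) = of_bool (adj u v)"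
  shows "runs deg_prog s (n * (4 * n + 6) + 3)
     (\<lambda>s'. (\<forall>x. x \<notin> {4, 5, 6, 7} \<longrightarrow> reg s' x = reg s x) \<and> (\<forall>a \<ge> - 2 * int n. mem s' a = mem s a) \<and>
        (\<forall>u<n. mem s' (- 1 - 2 * int n - int u) = int (count (adj u) n)))"
proof -
  define inv where "inv = (\<lambda>i (s' :: state). (\<forall>x. x \<notin> {4, 5, 6, 7} \<longrightarrow> reg s' x = reg s x) \<and>
    (\<forall>a \<ge> - 2 * int n. mem s' a = mem s a) \<and> reg s' 6 = int (i * n) \<and>
    (\<forall>u<i. mem s' (- 1 - 2 * int n - int u) = int (count (adj u) n)))"
  let ?inner = "For 5 (Reg 0) (Seq (Assign 7 (Plus (Reg 7) (Load (Reg 6)))) (Assign 6 (Plus (Reg 6) (Const 1))))"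
  have inner: "runs ?inner t (4 * n + 2) (\<lambda>t'. mem t' = mem t \<and>
      (\<forall>x. x \<notin> {5, 6, 7} \<longrightarrow> reg t' x = reg t x) \<and> reg t' 6 = int (Suc i * n) \<and> reg t' 7 = int (count (adj i) n))"
    if t: "inv i t" "reg t 7 = 0" "i < n" for i t
  proof (rule runs_For[where N = n and B = 2 and I = "\<lambda>j t'. mem t' = mem t \<and>
      (\<forall>x. x \<notin> {5, 6, 7} \<longrightarrow> reg t' x = reg t x) \<and> reg t' 6 = int (i * n + j) \<and> reg t' 7 = int (count (adj i) j)"])
    fix j and t' :: state assume j: "j < n" and t': "mem t' = mem t \<and>
      (\<forall>x. x \<notin> {5, 6, 7} \<longrightarrow> reg t' x = reg t x) \<and> reg t' 6 = int (i * n + j) \<and> reg t' 7 = int (count (adj i) j)"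
      "reg t' 5 = int j"
    have "- 2 * int n \<le> int (i * n + j)" by (rule order_trans[OF _ of_nat_0_le_iff]) simp
    then have "mem t' (reg t' 6) = mem s (int (i * n + j))"
      using t t' unfolding inv_def by metis
    then have "mem t' (reg t' 6) = of_bool (adj i j)" using adj[OF t(3) j] by simp
    then show "runs (Seq (Assign 7 (Plus (Reg 7) (Load (Reg 6)))) (Assign 6 (Plus (Reg 6) (Const 1)))) t' 2
      (\<lambda>s'. reg s' 5 = int j \<and> mem (s'\<lparr>reg := (reg s')(5 := int (Suc j))\<rparr>) = mem t \<and>
      (\<forall>x. x \<notin> {5, 6, 7} \<longrightarrow> reg (s'\<lparr>reg := (reg s')(5 := int (Suc j))\<rparr>) x = reg t x) \<and>
      reg (s'\<lparr>reg := (reg s')(5 := int (Suc j))\<rparr>) 6 = int (i * n + Suc j) \<and>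
      reg (s'\<lparr>reg := (reg s')(5 := int (Suc j))\<rparr>) 7 = int (count (adj i) (Suc j)))"
      using t' by (intro runs_loop_free) auto
  qed (use t n in \<open>auto simp: inv_def\<close>)
  show ?thesis unfolding deg_prog_def
  proof (rule runs_Seq)
    show "runs (Assign 6 (Const 0)) s 1 (inv 0)"
      by (rule runs_loop_free) (auto simp: inv_def)
    fix s' assume s': "inv 0 s'"
    show "runs (For 4 (Reg 0) (Seq (Assign 7 (Const 0)) (Seq ?inner (Store (deg_at (Reg 4)) (Reg 7)))))
      s' (n * (4 * n + 6) + 2) (\<lambda>s'. (\<forall>x. x \<notin> {4, 5, 6, 7} \<longrightarrow> reg s' x = reg s x) \<and>
        (\<forall>a \<ge> - 2 * int n. mem s' a = mem s a) \<and>
        (\<forall>u<n. mem s' (- 1 - 2 * int n - int u) = int (count (adj u) n)))"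
    proof (rule runs_For[where N = n and B = "4 * n + 4" and I = inv])
      fix i t assume i: "i < n" and t: "inv i t" "reg t 4 = int i"
      show "runs (Seq (Assign 7 (Const 0)) (Seq ?inner (Store (deg_at (Reg 4)) (Reg 7)))) t (4 * n + 4)
        (\<lambda>s'. reg s' 4 = int i \<and> inv (Suc i) (s'\<lparr>reg := (reg s')(4 := int (Suc i))\<rparr>))"
      proof (rule runs_Seq)
        show "runs (Assign 7 (Const 0)) t 1 (\<lambda>t. inv i t \<and> reg t 7 = 0 \<and> reg t 4 = int i)"
          by (rule runs_loop_free) (use t in \<open>auto simp: inv_def\<close>)
        fix t assume t: "inv i t \<and> reg t 7 = 0 \<and> reg t 4 = int i"
        show "runs (Seq ?inner (Store (deg_at (Reg 4)) (Reg 7))) t (4 * n + 3)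
          (\<lambda>s'. reg s' 4 = int i \<and> inv (Suc i) (s'\<lparr>reg := (reg s')(4 := int (Suc i))\<rparr>))"
        proof (rule runs_Seq[OF inner[of i t]])
          fix t' :: state assume t': "mem t' = mem t \<and> (\<forall>x. x \<notin> {5, 6, 7} \<longrightarrow> reg t' x = reg t x) \<and>
            reg t' 6 = int (Suc i * n) \<and> reg t' 7 = int (count (adj i) n)"
          show "runs (Store (deg_at (Reg 4)) (Reg 7)) t' 1
            (\<lambda>s'. reg s' 4 = int i \<and> inv (Suc i) (s'\<lparr>reg := (reg s')(4 := int (Suc i))\<rparr>))"
            by (rule runs_loop_free) (use t t' n in \<open>auto simp: inv_def at_defs less_Suc_eq distrib_right\<close>)
        qed (use t i in auto)
      qed simp
    qed (use s' n in \<open>auto simp: inv_def\<close>)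
  qed simp
qed

text \<open>Breaking ties by vertex number gives a strict total order. Counting predecessors then
  yields distinct ranks and replaces sorting.\<close>

definition precedes :: "(nat \<Rightarrow> nat) \<Rightarrow> nat \<Rightarrow> nat \<Rightarrow> bool" where
  "precedes d u v \<longleftrightarrow> d v < d u \<or> d u = d v \<and> u < v"

definition rank :: "(nat \<Rightarrow> nat) \<Rightarrow> nat \<Rightarrow> nat \<Rightarrow> nat" where
  "rank d n v = count (\<lambda>u. precedes d u v) n"

text \<open>The disjunction is expressed by De Morgan, and equality of degrees by the failure of
  both strict comparisons. Register 5 holds the possible predecessor of register 4.\<close>

definition precedes_exp :: bexp where
  "precedes_exp = NotB (AndB (NotB (Less (Load (deg_at (Reg 4))) (Load (deg_at (Reg 5)))))
     (NotB (AndB (NotB (Less (Load (deg_at (Reg 5))) (Load (deg_at (Reg 4))))) (Less (Reg 5) (Reg 4)))))"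

definition rank_prog :: com where
  "rank_prog = For 4 (Reg 0)
     (Seq (Assign 7 (Const 0))
     (Seq (For 5 (Reg 0) (Cond precedes_exp (Assign 7 (Plus (Reg 7) (Const 1))) Skip))
       (Store (rank_at (Reg 4)) (Reg 7))))"

lemma runs_rank_prog:
  assumes n: "reg s 0 = int n"
    and d: "\<And>u. u < n \<Longrightarrow> mem s (- 1 - 2 * int n - int u) = int (d u)"
  shows "runs rank_prog s (n * (4 * n + 6) + 2)
     (\<lambda>s'. (\<forall>x. x \<notin> {4, 5, 6, 7} \<longrightarrow> reg s' x = reg s x) \<and> (\<forall>a \<ge> - int n. mem s' a = mem s a) \<and>
        (\<forall>u<n. mem s' (- 1 - int n - int u) = int (rank d n u)))"
proof -
  define inv where "inv = (\<lambda>i (s' :: state). (\<forall>x. x \<notin> {4, 5, 6, 7} \<longrightarrow> reg s' x = reg s x) \<and>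
    (\<forall>a \<ge> - int n. mem s' a = mem s a) \<and> (\<forall>u<n. mem s' (- 1 - 2 * int n - int u) = int (d u)) \<and>
    (\<forall>u<i. mem s' (- 1 - int n - int u) = int (rank d n u)))"
  let ?inner = "For 5 (Reg 0) (Cond precedes_exp (Assign 7 (Plus (Reg 7) (Const 1))) Skip)"
  have inner: "runs ?inner t (4 * n + 2) (\<lambda>t'. mem t' = mem t \<and>
      (\<forall>x. x \<notin> {5, 7} \<longrightarrow> reg t' x = reg t x) \<and> reg t' 7 = int (rank d n i))"
    if t: "inv i t" "reg t 7 = 0" "reg t 4 = int i" "i < n" for i t
  proof (rule runs_For[where N = n and B = 2 and I = "\<lambda>j t'. mem t' = mem t \<and>
      (\<forall>x. x \<notin> {5, 7} \<longrightarrow> reg t' x = reg t x) \<and> reg t' 7 = int (count (\<lambda>u. precedes d u i) j)"])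
    fix j and t' :: state assume j: "j < n" and t': "mem t' = mem t \<and>
      (\<forall>x. x \<notin> {5, 7} \<longrightarrow> reg t' x = reg t x) \<and> reg t' 7 = int (count (\<lambda>u. precedes d u i) j)"
      "reg t' 5 = int j"
    have "mem t (- 1 - 2 * int n - int i) = int (d i)" "mem t (- 1 - 2 * int n - int j) = int (d j)"
      using t j by (auto simp: inv_def)
    then have *: "bval precedes_exp t' \<longleftrightarrow> precedes d j i"
      using t t' n by (auto simp: precedes_exp_def precedes_def at_defs inv_def algebra_simps)
    show "runs (Cond precedes_exp (Assign 7 (Plus (Reg 7) (Const 1))) Skip) t' 2
      (\<lambda>s'. reg s' 5 = int j \<and> mem (s'\<lparr>reg := (reg s')(5 := int (Suc j))\<rparr>) = mem t \<and>
      (\<forall>x. x \<notin> {5, 7} \<longrightarrow> reg (s'\<lparr>reg := (reg s')(5 := int (Suc j))\<rparr>) x = reg t x) \<and>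
      reg (s'\<lparr>reg := (reg s')(5 := int (Suc j))\<rparr>) 7 = int (count (\<lambda>u. precedes d u i) (Suc j)))"
      using t' by (intro runs_loop_free) (auto simp: *)
  qed (use t n in \<open>auto simp: inv_def rank_def\<close>)
  show ?thesis unfolding rank_prog_def
  proof (rule runs_For[where N = n and B = "4 * n + 4" and I = inv])
    fix i t assume i: "i < n" and t: "inv i t" "reg t 4 = int i"
    show "runs (Seq (Assign 7 (Const 0)) (Seq ?inner (Store (rank_at (Reg 4)) (Reg 7)))) t (4 * n + 4)
      (\<lambda>s'. reg s' 4 = int i \<and> inv (Suc i) (s'\<lparr>reg := (reg s')(4 := int (Suc i))\<rparr>))"
    proof (rule runs_Seq)
      show "runs (Assign 7 (Const 0)) t 1 (\<lambda>t. inv i t \<and> reg t 7 = 0 \<and> reg t 4 = int i)"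
        by (rule runs_loop_free) (use t in \<open>auto simp: inv_def\<close>)
      fix t assume t: "inv i t \<and> reg t 7 = 0 \<and> reg t 4 = int i"
      show "runs (Seq ?inner (Store (rank_at (Reg 4)) (Reg 7))) t (4 * n + 3)
        (\<lambda>s'. reg s' 4 = int i \<and> inv (Suc i) (s'\<lparr>reg := (reg s')(4 := int (Suc i))\<rparr>))"
      proof (rule runs_Seq[OF inner[of i t]])
        fix t' :: state assume t': "mem t' = mem t \<and> (\<forall>x. x \<notin> {5, 7} \<longrightarrow> reg t' x = reg t x) \<and>
          reg t' 7 = int (rank d n i)"
        show "runs (Store (rank_at (Reg 4)) (Reg 7)) t' 1
          (\<lambda>s'. reg s' 4 = int i \<and> inv (Suc i) (s'\<lparr>reg := (reg s')(4 := int (Suc i))\<rparr>))"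
          by (rule runs_loop_free) (use t t' n i in \<open>auto simp: inv_def at_defs less_Suc_eq\<close>)
      qed (use t i in auto)
    qed simp
  qed (use n d in \<open>auto simp: inv_def\<close>)
qed

text \<open>The \<open>j\<close>-th candidate, in terms of ranks: the binary digits of \<open>j\<close> select among the first \<open>g\<close>
  ranks, and the following ranks are added until there are \<open>k\<close>.\<close>

fun cand_size :: "nat \<Rightarrow> int \<Rightarrow> nat \<Rightarrow> nat \<Rightarrow> nat" where
  "cand_size g k j 0 = 0"
| "cand_size g k j (Suc i) = cand_size g k j i +
     of_bool (if i < g then odd (j div 2 ^ i) else int (cand_size g k j i) < k)"

definition cand :: "nat \<Rightarrow> int \<Rightarrow> nat \<Rightarrow> nat \<Rightarrow> bool" where
  "cand g k j i \<longleftrightarrow> (if i < g then odd (j div 2 ^ i) else int (cand_size g k j i) < k)"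

text \<open>A single sweep increments the counter by ripple carry on the first \<open>g\<close>
  cells, refills the others greedily, and keeps the running size in register 8. A carry left at the
  end means that the counter has wrapped.\<close>

definition next_prog :: com where
  "next_prog = Seq (Assign 8 (Const 0)) (Seq (Assign 9 (Const 1)) (For 4 (Reg 0)
     (Seq (Cond (Less (Reg 4) (Reg 3))
        (Cond (Less (Const 0) (Reg 9))
          (Cond (Less (Const 0) (Load (bit_at (Reg 4))))
            (Store (bit_at (Reg 4)) (Const 0))
            (Seq (Store (bit_at (Reg 4)) (Const 1)) (Assign 9 (Const 0))))
          Skip)
        (Cond (Less (Reg 8) (Reg 1)) (Store (bit_at (Reg 4)) (Const 1)) (Store (bit_at (Reg 4)) (Const 0))))
      (Assign 8 (Plus (Reg 8) (Load (bit_at (Reg 4))))))))"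

text \<open>Ripple carry: the carry reaches digit \<open>i\<close> exactly when
  \<open>2 ^ i dvd Suc j\<close>, and then it flips that digit.\<close>

lemma odd_Suc_div_power:
  "odd (Suc j div 2 ^ i) \<longleftrightarrow> odd (j div 2 ^ i) \<noteq> (2 ^ i dvd Suc j)"
  by (auto simp: div_Suc simp flip: dvd_eq_mod_eq_0)

lemma power_Suc_dvd_iff:
  "(2::nat) ^ Suc i dvd m \<longleftrightarrow> 2 ^ i dvd m \<and> even (m div 2 ^ i)"
proof
  assume "2 ^ Suc i dvd m"
  then obtain q where "m = 2 ^ Suc i * q" by (elim dvdE)
  then show "2 ^ i dvd m \<and> even (m div 2 ^ i)" by (simp add: mult.assoc)
next
  assume "2 ^ i dvd m \<and> even (m div 2 ^ i)"
  then show "2 ^ Suc i dvd m" by (metis dvd_mult_div_cancel mult_dvd_mono dvd_refl power_Suc2)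
qed

lemma runs_next_prog:
  assumes n: "reg s 0 = int n" and k: "reg s 1 = k" and g: "reg s 3 = int g" "g \<le> n"
    and bits: "\<And>i. i < g \<Longrightarrow> mem s (- 1 - int i) = of_bool (odd (j div 2 ^ i))"
  shows "runs next_prog s (n * 8 + 4)
     (\<lambda>s'. (\<forall>x. x \<notin> {4, 8, 9} \<longrightarrow> reg s' x = reg s x) \<and>
        (\<forall>a. 0 \<le> a \<or> a < - int n \<longrightarrow> mem s' a = mem s a) \<and>
        (\<forall>i<n. mem s' (- 1 - int i) = of_bool (cand g k (Suc j) i)) \<and>
        reg s' 8 = int (cand_size g k (Suc j) n) \<and> reg s' 9 = of_bool (2 ^ g dvd Suc j))"
proof -
  \<comment> \<open>Cells from \<open>i\<close> up to \<open>g\<close> still hold digits of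
    \<open>j\<close>, those below \<open>i\<close> already belong to \<open>Suc j\<close>. The carry
    is frozen beyond the counter, hence \<open>min i g\<close>.\<close>
  define inv where "inv = (\<lambda>i (s' :: state). (\<forall>x. x \<notin> {4, 8, 9} \<longrightarrow> reg s' x = reg s x) \<and>
    (\<forall>a. 0 \<le> a \<or> a < - int n \<longrightarrow> mem s' a = mem s a) \<and>
    (\<forall>l<i. mem s' (- 1 - int l) = of_bool (cand g k (Suc j) l)) \<and>
    (\<forall>l. i \<le> l \<longrightarrow> l < g \<longrightarrow> mem s' (- 1 - int l) = of_bool (odd (j div 2 ^ l))) \<and>
    reg s' 8 = int (cand_size g k (Suc j) i) \<and> reg s' 9 = of_bool (2 ^ min i g dvd Suc j))"
  show ?thesis unfolding next_prog_def
  proof (rule runs_Seq)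
    show "runs (Assign 8 (Const 0)) s 1 (\<lambda>s'. s' = s\<lparr>reg := (reg s)(8 := 0)\<rparr>)"
      by (rule runs_loop_free) auto
    fix s1 assume s1: "s1 = s\<lparr>reg := (reg s)(8 := 0)\<rparr>"
    show "runs (Seq (Assign 9 (Const 1)) (For 4 (Reg 0)
       (Seq (Cond (Less (Reg 4) (Reg 3))
          (Cond (Less (Const 0) (Reg 9))
            (Cond (Less (Const 0) (Load (bit_at (Reg 4))))
              (Store (bit_at (Reg 4)) (Const 0))
              (Seq (Store (bit_at (Reg 4)) (Const 1)) (Assign 9 (Const 0))))
            Skip)
          (Cond (Less (Reg 8) (Reg 1)) (Store (bit_at (Reg 4)) (Const 1)) (Store (bit_at (Reg 4)) (Const 0))))
        (Assign 8 (Plus (Reg 8) (Load (bit_at (Reg 4)))))))) s1 (n * 8 + 3)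
     (\<lambda>s'. (\<forall>x. x \<notin> {4, 8, 9} \<longrightarrow> reg s' x = reg s x) \<and>
        (\<forall>a. 0 \<le> a \<or> a < - int n \<longrightarrow> mem s' a = mem s a) \<and>
        (\<forall>i<n. mem s' (- 1 - int i) = of_bool (cand g k (Suc j) i)) \<and>
        reg s' 8 = int (cand_size g k (Suc j) n) \<and> reg s' 9 = of_bool (2 ^ g dvd Suc j))"
      (is "runs (Seq _ (For _ _ ?body)) _ _ _")
    proof (rule runs_Seq)
      show "runs (Assign 9 (Const 1)) s1 1 (inv 0)"
        by (rule runs_loop_free) (use bits in \<open>auto simp: s1 inv_def\<close>)
      fix s2 assume s2: "inv 0 s2"
      show "runs (For 4 (Reg 0) ?body) s2 (n * 8 + 2)
       (\<lambda>s'. (\<forall>x. x \<notin> {4, 8, 9} \<longrightarrow> reg s' x = reg s x) \<and>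
        (\<forall>a. 0 \<le> a \<or> a < - int n \<longrightarrow> mem s' a = mem s a) \<and>
        (\<forall>i<n. mem s' (- 1 - int i) = of_bool (cand g k (Suc j) i)) \<and>
        reg s' 8 = int (cand_size g k (Suc j) n) \<and> reg s' 9 = of_bool (2 ^ g dvd Suc j))"
      proof (rule runs_For[where N = n and B = 6 and I = inv])
        fix i t assume i: "i < n" and t: "inv i t" "reg t 4 = int i"
        show "runs ?body t 6 (\<lambda>s'. reg s' 4 = int i \<and> inv (Suc i) (s'\<lparr>reg := (reg s')(4 := int (Suc i))\<rparr>))"
        proof (rule runs_loop_free)
          have r: "reg t 1 = k" "reg t 3 = int g" using t k g by (auto simp: inv_def)
          show "reg (effect ?body t) 4 = int i \<and>
            inv (Suc i) (effect ?body t\<lparr>reg := (reg (effect ?body t))(4 := int (Suc i))\<rparr>)"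
          proof (cases "i < g")
            case True
            then have c: "cand g k (Suc j) i \<longleftrightarrow> odd (j div 2 ^ i) \<noteq> (2 ^ i dvd Suc j)"
              "cand_size g k (Suc j) (Suc i) = cand_size g k (Suc j) i + of_bool (cand g k (Suc j) i)"
              by (auto simp: cand_def odd_Suc_div_power)
            have carry: "2 * 2 ^ i dvd Suc j \<longleftrightarrow> 2 ^ i dvd Suc j \<and> odd (j div 2 ^ i)"
              using power_Suc_dvd_iff[of i "Suc j"] odd_Suc_div_power[of j i] by auto
            have now: "mem t (- 1 - int i) = of_bool (odd (j div 2 ^ i))" "reg t 9 = of_bool (2 ^ i dvd Suc j)"
              using t True by (auto simp: inv_def)
            show ?thesis
              using t True i r now
              by (cases "2 ^ i dvd Suc j"; cases "odd (j div 2 ^ i)")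
                (auto simp del: cand_size.simps simp: inv_def at_defs less_Suc_eq c carry)
          next
            case False
            then have c: "cand g k (Suc j) i \<longleftrightarrow> int (cand_size g k (Suc j) i) < k"
              "cand_size g k (Suc j) (Suc i) = cand_size g k (Suc j) i + of_bool (cand g k (Suc j) i)"
              "min (Suc i) g = min i g"
              by (auto simp: cand_def)
            show ?thesis
              using t False i r
              by (cases "int (cand_size g k (Suc j) i) < k")
                (auto simp del: cand_size.simps simp: inv_def at_defs less_Suc_eq c)
          qed
        qed auto
      qed (use s2 n g in \<open>auto simp: inv_def min_def\<close>)
    qed simp
  qed simp
qed

text \<open>Bits are indexed by rank, so a vertex is looked up by double indirection. Ordered pairs
  are visited, and asking for the first endpoint inside and the second outside counts each cut edge
  once.\<close>

definition cut_prog :: com where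
  "cut_prog = Seq (Assign 6 (Const 0)) (Seq (Assign 7 (Const 0)) (For 4 (Reg 0) (For 5 (Reg 0)
     (Seq (Cond (AndB (Less (Const 0) (Load (Reg 6)))
          (AndB (Less (Const 0) (Load (bit_at (Load (rank_at (Reg 4))))))
            (Less (Load (bit_at (Load (rank_at (Reg 5))))) (Const 1))))
        (Assign 7 (Plus (Reg 7) (Const 1))) Skip)
      (Assign 6 (Plus (Reg 6) (Const 1)))))))"

lemma runs_cut_prog:
  assumes n: "reg s 0 = int n"
    and adj: "\<And>u v. u < n \<Longrightarrow> v < n \<Longrightarrow> mem s (int (u * n + v)) = of_bool (adj u v)"
    and rank: "\<And>u. u < n \<Longrightarrow> mem s (- 1 - int n - int u) = int (r u)" "\<And>u. u < n \<Longrightarrow> r u < n"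
    and bits: "\<And>i. i < n \<Longrightarrow> mem s (- 1 - int i) = of_bool (b i)"
  shows "runs cut_prog s (n * (5 * n + 4) + 4)
     (\<lambda>s'. (\<forall>x. x \<notin> {4, 5, 6, 7} \<longrightarrow> reg s' x = reg s x) \<and> mem s' = mem s \<and>
        reg s' 7 = int (\<Sum>u<n. count (\<lambda>v. adj u v \<and> b (r u) \<and> \<not> b (r v)) n))"
proof -
  define c where "c = (\<lambda>u. count (\<lambda>v. adj u v \<and> b (r u) \<and> \<not> b (r v)))"
  define inv where "inv = (\<lambda>i (s' :: state). (\<forall>x. x \<notin> {4, 5, 6, 7} \<longrightarrow> reg s' x = reg s x) \<and> mem s' = mem s \<and>
    reg s' 6 = int (i * n) \<and> reg s' 7 = int (\<Sum>u<i. c u n))"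
  let ?body = "Seq (Cond (AndB (Less (Const 0) (Load (Reg 6)))
          (AndB (Less (Const 0) (Load (bit_at (Load (rank_at (Reg 4))))))
            (Less (Load (bit_at (Load (rank_at (Reg 5))))) (Const 1))))
        (Assign 7 (Plus (Reg 7) (Const 1))) Skip)
      (Assign 6 (Plus (Reg 6) (Const 1)))"
  have inner: "runs (For 5 (Reg 0) ?body) t (5 * n + 2)
      (\<lambda>s'. reg s' 4 = int i \<and> inv (Suc i) (s'\<lparr>reg := (reg s')(4 := int (Suc i))\<rparr>))"
    if t: "inv i t" "reg t 4 = int i" "i < n" for i t
  proof (rule runs_For[where N = n and B = 3 and
        I = "\<lambda>j s'. (\<forall>x. x \<notin> {4, 5, 6, 7} \<longrightarrow> reg s' x = reg s x) \<and> mem s' = mem s \<and>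
          reg s' 4 = int i \<and> reg s' 6 = int (i * n + j) \<and> reg s' 7 = int ((\<Sum>u<i. c u n) + c i j)"])
    fix j and t' :: state assume j: "j < n" and t': "(\<forall>x. x \<notin> {4, 5, 6, 7} \<longrightarrow> reg t' x = reg s x) \<and> mem t' = mem s \<and>
          reg t' 4 = int i \<and> reg t' 6 = int (i * n + j) \<and> reg t' 7 = int ((\<Sum>u<i. c u n) + c i j)"
      "reg t' 5 = int j"
    have m: "mem s (reg t' 6) = of_bool (adj i j)" using adj[OF t(3) j] t' by simp
    have ri: "mem s (- 1 - mem s (- 1 - int i - int n)) = of_bool (b (r i))"
      using rank[OF t(3)] bits[of "r i"] by (simp add: algebra_simps)
    have rj: "mem s (- 1 - mem s (- 1 - int j - int n)) = of_bool (b (r j))"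
      using rank[OF j] bits[of "r j"] by (simp add: algebra_simps)
    have cS: "c i (Suc j) = c i j + of_bool (adj i j \<and> b (r i) \<and> \<not> b (r j))"
      by (simp add: c_def)
    show "runs ?body t' 3 (\<lambda>s'. reg s' 5 = int j \<and>
      (\<forall>x. x \<notin> {4, 5, 6, 7} \<longrightarrow> reg (s'\<lparr>reg := (reg s')(5 := int (Suc j))\<rparr>) x = reg s x) \<and>
      mem (s'\<lparr>reg := (reg s')(5 := int (Suc j))\<rparr>) = mem s \<and>
      reg (s'\<lparr>reg := (reg s')(5 := int (Suc j))\<rparr>) 4 = int i \<and>
      reg (s'\<lparr>reg := (reg s')(5 := int (Suc j))\<rparr>) 6 = int (i * n + Suc j) \<and>
      reg (s'\<lparr>reg := (reg s')(5 := int (Suc j))\<rparr>) 7 = int ((\<Sum>u<i. c u n) + c i (Suc j)))"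
    proof (rule runs_loop_free)
      let ?cond = "AndB (Less (Const 0) (Load (Reg 6)))
          (AndB (Less (Const 0) (Load (bit_at (Load (rank_at (Reg 4))))))
            (Less (Load (bit_at (Load (rank_at (Reg 5))))) (Const 1)))"
      have "bval ?cond t' \<longleftrightarrow> adj i j \<and> b (r i) \<and> \<not> b (r j)"
        using t' n m ri rj by (auto simp: at_defs)
      then have "effect ?body t' = t'\<lparr>reg := (reg t')(7 := reg t' 7 + of_bool (adj i j \<and> b (r i) \<and> \<not> b (r j)),
          6 := reg t' 6 + 1)\<rparr>"
        by (simp del: bval.simps)
      then show "reg (effect ?body t') 5 = int j \<and>
      (\<forall>x. x \<notin> {4, 5, 6, 7} \<longrightarrow> reg (effect ?body t'\<lparr>reg := (reg (effect ?body t'))(5 := int (Suc j))\<rparr>) x = reg s x) \<and>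
      mem (effect ?body t'\<lparr>reg := (reg (effect ?body t'))(5 := int (Suc j))\<rparr>) = mem s \<and>
      reg (effect ?body t'\<lparr>reg := (reg (effect ?body t'))(5 := int (Suc j))\<rparr>) 4 = int i \<and>
      reg (effect ?body t'\<lparr>reg := (reg (effect ?body t'))(5 := int (Suc j))\<rparr>) 6 = int (i * n + Suc j) \<and>
      reg (effect ?body t'\<lparr>reg := (reg (effect ?body t'))(5 := int (Suc j))\<rparr>) 7 = int ((\<Sum>u<i. c u n) + c i (Suc j))"
        using t' unfolding cS by (simp del: effect.simps)
    qed auto
  next
    fix t' :: state assume "(\<forall>x. x \<notin> {4, 5, 6, 7} \<longrightarrow> reg t' x = reg s x) \<and> mem t' = mem s \<and>
          reg t' 4 = int i \<and> reg t' 6 = int (i * n + n) \<and> reg t' 7 = int ((\<Sum>u<i. c u n) + c i n)"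
    then show "reg t' 4 = int i \<and> inv (Suc i) (t'\<lparr>reg := (reg t')(4 := int (Suc i))\<rparr>)"
      by (auto simp: inv_def algebra_simps)
  qed (use t n in \<open>auto simp: inv_def c_def\<close>)
  show ?thesis unfolding cut_prog_def
  proof (rule runs_Seq)
    show "runs (Assign 6 (Const 0)) s 1 (\<lambda>s'. s' = s\<lparr>reg := (reg s)(6 := 0)\<rparr>)"
      by (rule runs_loop_free) auto
    fix s1 assume s1: "s1 = s\<lparr>reg := (reg s)(6 := 0)\<rparr>"
    show "runs (Seq (Assign 7 (Const 0)) (For 4 (Reg 0) (For 5 (Reg 0) ?body))) s1 (n * (5 * n + 4) + 3)
      (\<lambda>s'. (\<forall>x. x \<notin> {4, 5, 6, 7} \<longrightarrow> reg s' x = reg s x) \<and> mem s' = mem s \<and>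
        reg s' 7 = int (\<Sum>u<n. count (\<lambda>v. adj u v \<and> b (r u) \<and> \<not> b (r v)) n))"
    proof (rule runs_Seq)
      show "runs (Assign 7 (Const 0)) s1 1 (inv 0)"
        by (rule runs_loop_free) (auto simp: s1 inv_def)
      fix s2 assume s2: "inv 0 s2"
      show "runs (For 4 (Reg 0) (For 5 (Reg 0) ?body)) s2 (n * (5 * n + 4) + 2)
        (\<lambda>s'. (\<forall>x. x \<notin> {4, 5, 6, 7} \<longrightarrow> reg s' x = reg s x) \<and> mem s' = mem s \<and>
          reg s' 7 = int (\<Sum>u<n. count (\<lambda>v. adj u v \<and> b (r u) \<and> \<not> b (r v)) n))"
      proof (rule runs_For[where N = n and B = "5 * n + 2" and I = inv])
        show "n * (5 * n + 2 + 2) + 2 \<le> n * (5 * n + 4) + 2" by (simp add: algebra_simps)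
      qed (use s2 n inner in \<open>auto simp: inv_def c_def\<close>)
    qed simp
  qed simp
qed

text \<open>The greedy filling need not end at size \<open>k\<close>: the digits may select too many
  ranks, or \<open>k\<close> may be negative or exceed \<open>n\<close>. The size test rejects such
  candidates.\<close>

definition accepts :: "nat \<Rightarrow> int \<Rightarrow> int \<Rightarrow> (nat \<Rightarrow> nat \<Rightarrow> bool) \<Rightarrow> (nat \<Rightarrow> nat) \<Rightarrow> nat \<Rightarrow> nat \<Rightarrow> bool" where
  "accepts g k p adj r n j \<longleftrightarrow> int (cand_size g k j n) = k \<and>
     p \<le> int (\<Sum>u<n. count (\<lambda>v. adj u v \<and> cand g k j (r u) \<and> \<not> cand g k j (r v)) n)"

definition check_prog :: com where
  "check_prog = Cond (AndB (NotB (Less (Reg 8) (Reg 1))) (AndB (NotB (Less (Reg 1) (Reg 8))) (NotB (Less (Reg 7) (Reg 2)))))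
     (Assign 10 (Const 1)) Skip"

text \<open>The counter is incremented before the first test and wraps around, so that the zero
  vector is tested last.\<close>

definition search_prog :: com where
  "search_prog = While (Less (Reg 9) (Const 1)) (Seq next_prog (Seq cut_prog check_prog))"

lemma runs_search_prog:
  assumes s: "reg s 0 = int n" "reg s 1 = k" "reg s 2 = p" "reg s 3 = int g" "g \<le> n" "reg s 9 = 0" "reg s 10 = 0"
    and adj: "\<And>u v. u < n \<Longrightarrow> v < n \<Longrightarrow> mem s (int (u * n + v)) = of_bool (adj u v)"
    and rank: "\<And>u. u < n \<Longrightarrow> mem s (- 1 - int n - int u) = int (r u)" "\<And>u. u < n \<Longrightarrow> r u < n"
    and bits: "\<And>i. i < n \<Longrightarrow> mem s (- 1 - int i) = 0"
  shows "runs search_prog s (2 ^ g * (n * 8 + n * (5 * n + 4) + 11) + 1)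
     (\<lambda>s'. reg s' 10 = of_bool (\<exists>j\<in>{1..2 ^ g}. accepts g k p adj r n j))"
proof -
  \<comment> \<open>The conjunct \<open>0 < j\<close> covers the start, where the carry is 0
    although \<open>2 ^ g\<close> divides 0. The next multiple is \<open>2 ^ g\<close> itself, so
    the loop makes exactly \<open>2 ^ g\<close> rounds.\<close>
  define inv where "inv = (\<lambda>j (t :: state). (\<forall>x\<in>{0, 1, 2, 3}. reg t x = reg s x) \<and>
    (\<forall>a. 0 \<le> a \<or> a < - int n \<longrightarrow> mem t a = mem s a) \<and>
    (\<forall>i<g. mem t (- 1 - int i) = of_bool (odd (j div 2 ^ i))) \<and>
    reg t 9 = of_bool (0 < j \<and> 2 ^ g dvd j) \<and>
    reg t 10 = of_bool (\<exists>i\<in>{1..j}. accepts g k p adj r n i))"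
  show ?thesis unfolding search_prog_def
  proof (rule runs_While[where I = inv and N = "2 ^ g" and B = "n * 8 + n * (5 * n + 4) + 10"])
    show "inv 0 s" using s bits by (auto simp: inv_def)
  next
    fix t assume "inv (2 ^ g) t"
    then show "\<not> bval (Less (Reg 9) (Const 1)) t \<and> reg t 10 = of_bool (\<exists>j\<in>{1..2 ^ g}. accepts g k p adj r n j)"
      by (auto simp: inv_def)
  next
    fix j t assume j: "j < (2 :: nat) ^ g" and t: "inv j t"
    have "\<not> (0 < j \<and> 2 ^ g dvd j)" using j dvd_imp_le by fastforce
    then have "reg t 9 = 0" using t by (simp add: inv_def)
    then have cond: "bval (Less (Reg 9) (Const 1)) t" by simp
    have "runs (Seq next_prog (Seq cut_prog check_prog)) t (n * 8 + n * (5 * n + 4) + 10) (inv (Suc j))"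
    proof (rule runs_Seq[OF runs_next_prog[of t n k g j]])
      fix t1 :: state assume t1: "(\<forall>x. x \<notin> {4, 8, 9} \<longrightarrow> reg t1 x = reg t x) \<and>
        (\<forall>a. 0 \<le> a \<or> a < - int n \<longrightarrow> mem t1 a = mem t a) \<and>
        (\<forall>i<n. mem t1 (- 1 - int i) = of_bool (cand g k (Suc j) i)) \<and>
        reg t1 8 = int (cand_size g k (Suc j) n) \<and> reg t1 9 = of_bool (2 ^ g dvd Suc j)"
      have mem1: "mem t1 a = mem s a" if "0 \<le> a \<or> a < - int n" for a
        using t t1 that by (auto simp: inv_def)
      show "runs (Seq cut_prog check_prog) t1 (n * (5 * n + 4) + 6) (inv (Suc j))"
      proof (rule runs_Seq[OF runs_cut_prog[of t1 n adj r "cand g k (Suc j)"]])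
        fix t2 :: state assume t2: "(\<forall>x. x \<notin> {4, 5, 6, 7} \<longrightarrow> reg t2 x = reg t1 x) \<and> mem t2 = mem t1 \<and>
          reg t2 7 = int (\<Sum>u<n. count (\<lambda>v. adj u v \<and> cand g k (Suc j) (r u) \<and> \<not> cand g k (Suc j) (r v)) n)"
        have acc: "accepts g k p adj r n (Suc j) \<longleftrightarrow> reg t2 8 = reg t2 1 \<and> reg t2 2 \<le> reg t2 7"
          using t t1 t2 s by (simp add: accepts_def inv_def)
        have "(\<exists>i\<in>{1..Suc j}. accepts g k p adj r n i) \<longleftrightarrow>
          (\<exists>i\<in>{1..j}. accepts g k p adj r n i) \<or> accepts g k p adj r n (Suc j)"
          by (subst atLeastAtMostSuc_conv) auto
        then have "inv (Suc j) (effect check_prog t2)"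
          using t t1 t2 s(5) acc by (auto simp: check_prog_def inv_def cand_def)
        then show "runs check_prog t2 2 (inv (Suc j))"
          by (intro runs_loop_free) (auto simp: check_prog_def)
      qed (use t t1 s adj rank mem1 in \<open>auto simp: inv_def simp del: of_nat_add of_nat_mult\<close>)
    qed (use t s in \<open>auto simp: inv_def\<close>)
    with cond show "bval (Less (Reg 9) (Const 1)) t \<and>
      runs (Seq next_prog (Seq cut_prog check_prog)) t (n * 8 + n * (5 * n + 4) + 10) (inv (Suc j))" by blast
  qed simp
qed

text \<open>The carry, the result and the bit cells are not initialised: the input state has zeros
  there, and the phases before the search preserve them.\<close>

definition max_cut_prog :: com where
  "max_cut_prog = Seq bound_prog (Seq (Cond (Less (Reg 0) (Reg 3)) (Assign 3 (Reg 0)) Skip)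
     (Seq deg_prog (Seq rank_prog (Seq search_prog (Assign 0 (Reg 10))))))"

section \<open>Correctness of the candidate search\<close>

text \<open>By transitivity \<open>v\<close> inherits all predecessors of \<open>u\<close>, and
  \<open>u\<close> itself is an additional one.\<close>

lemma rank_mono:
  assumes "u < n" "precedes d u v"
  shows "rank d n u < rank d n v"
  unfolding rank_def count_def
proof (rule psubset_card_mono)
  show "{w. w < n \<and> precedes d w u} \<subset> {w. w < n \<and> precedes d w v}"
    using assms by (auto simp: precedes_def)
qed simp

lemma rank_less:
  assumes "v < n"
  shows "rank d n v < n"
proof -
  have "{w. w < n \<and> precedes d w v} \<subset> {..<n}" using assms by (auto simp: precedes_def)
  then have "card {w. w < n \<and> precedes d w v} < card {..<n}" by (intro psubset_card_mono) auto
  then show ?thesis by (simp add: rank_def count_def)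
qed

lemma bij_betw_rank: "bij_betw (rank d n) {..<n} {..<n}"
proof -
  have "inj_on (rank d n) {..<n}"
  proof (rule inj_onI)
    fix u v assume uv: "u \<in> {..<n}" "v \<in> {..<n}" "rank d n u = rank d n v"
    then have "\<not> precedes d u v" "\<not> precedes d v u" using rank_mono[of u n d v] rank_mono[of v n d u] by auto
    then show "u = v" by (auto simp: precedes_def)
  qed
  moreover have "rank d n ` {..<n} \<subseteq> {..<n}" using rank_less by auto
  ultimately show ?thesis by (simp add: bij_betw_def endo_inj_surj)
qed

lemma degree_antimono_rank:
  assumes "v < n" "rank d n u \<le> rank d n v"
  shows "d v \<le> d u"
  using assms rank_mono[of v n d u] by (force simp: precedes_def)

lemma runs_max_cut_prog:
  assumes s: "reg s 0 = int n" "reg s 1 = k" "reg s 2 = p" "reg s 9 = 0" "reg s 10 = 0"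
    and adj: "\<And>u v. u < n \<Longrightarrow> v < n \<Longrightarrow> mem s (int (u * n + v)) = of_bool (adj u v)"
    and zero: "\<And>a. a < 0 \<Longrightarrow> mem s a = 0"
    and g: "g = min (bound p) n" and r: "r = rank (\<lambda>u. count (adj u) n) n"
  shows "runs max_cut_prog s (5 * nat p + 2 * (n * (4 * n + 6)) + 2 ^ g * (n * 8 + n * (5 * n + 4) + 11) + 12)
     (\<lambda>s'. reg s' 0 = of_bool (\<exists>j\<in>{1..2 ^ g}. accepts g k p adj r n j))"
proof -
  \<comment> \<open>The parameter \<open>l\<close> is the number of negative cells known to be
    untouched: \<open>2 * n\<close> until the ranks are written, \<open>n\<close>
    afterwards.\<close>
  define base where "base = (\<lambda>l (t :: state). (\<forall>x\<in>{0, 1, 2, 9, 10}. reg t x = reg s x) \<and>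
    (\<forall>a \<ge> - int l. mem t a = mem s a))"
  let ?Q = "\<lambda>s'. reg s' 0 = of_bool (\<exists>j\<in>{1..2 ^ g}. accepts g k p adj r n j)"
  let ?c5 = "Seq search_prog (Assign 0 (Reg 10))"
  let ?c4 = "Seq rank_prog ?c5"
  let ?c3 = "Seq deg_prog ?c4"
  let ?min = "Cond (Less (Reg 0) (Reg 3)) (Assign 3 (Reg 0)) Skip"
  let ?T = "2 ^ g * (n * 8 + n * (5 * n + 4) + 11)"
  have adj': "mem t (int (u * n + v)) = of_bool (adj u v)" if "base l t" "u < n" "v < n" for l t u v
  proof -
    have "- int l \<le> int (u * n + v)" by (rule order_trans[OF _ of_nat_0_le_iff]) simp
    then show ?thesis using that adj unfolding base_def by metis
  qed
  have 5: "runs ?c5 t (?T + 2) ?Q"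
    if t: "base n t" "reg t 3 = int g" "\<forall>u<n. mem t (- 1 - int n - int u) = int (r u)" for t
  proof (rule runs_Seq[OF runs_search_prog[of t n k p g adj r]])
    show "mem t (int (u * n + v)) = of_bool (adj u v)" if "u < n" "v < n" for u v
      using adj'[OF t(1)] that .
    show "mem t (- 1 - int i) = 0" if "i < n" for i
      using t(1) zero[of "- 1 - int i"] that by (simp add: base_def)
    show "runs (Assign 0 (Reg 10)) t' 1 ?Q"
      if "reg t' 10 = of_bool (\<exists>j\<in>{1..2 ^ g}. accepts g k p adj r n j)" for t'
      using that by (intro runs_loop_free) auto
  qed (use t s in \<open>auto simp: base_def g r rank_less\<close>)
  have 4: "runs ?c4 t (n * (4 * n + 6) + ?T + 4) ?Q"
    if t: "base (2 * n) t" "reg t 3 = int g"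
      "\<forall>u<n. mem t (- 1 - 2 * int n - int u) = int (count (adj u) n)" for t
  proof (rule runs_Seq[OF runs_rank_prog[of t n "\<lambda>u. count (adj u) n"]])
    fix t' :: state assume "(\<forall>x. x \<notin> {4, 5, 6, 7} \<longrightarrow> reg t' x = reg t x) \<and> (\<forall>a \<ge> - int n. mem t' a = mem t a) \<and>
        (\<forall>u<n. mem t' (- 1 - int n - int u) = int (rank (\<lambda>u. count (adj u) n) n u))"
    then show "runs ?c5 t' (?T + 2) ?Q" using t by (intro 5) (auto simp: base_def r)
  qed (use t s in \<open>auto simp: base_def\<close>)
  have 3: "runs ?c3 t (2 * (n * (4 * n + 6)) + ?T + 7) ?Q"
    if t: "base (2 * n) t" "reg t 3 = int g" for t
  proof (rule runs_Seq[OF runs_deg_prog[of t n adj]])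
    fix t' :: state assume "(\<forall>x. x \<notin> {4, 5, 6, 7} \<longrightarrow> reg t' x = reg t x) \<and> (\<forall>a \<ge> - 2 * int n. mem t' a = mem t a) \<and>
        (\<forall>u<n. mem t' (- 1 - 2 * int n - int u) = int (count (adj u) n))"
    then show "runs ?c4 t' (n * (4 * n + 6) + ?T + 4) ?Q" using t by (intro 4) (auto simp: base_def)
  next
    show "mem t (int (u * n + v)) = of_bool (adj u v)" if "u < n" "v < n" for u v
      using adj'[OF t(1)] that .
  qed (use t s in \<open>auto simp: base_def\<close>)
  show ?thesis unfolding max_cut_prog_def
  proof (rule runs_Seq[OF runs_bound_prog])
    fix t :: state assume t: "mem t = mem s \<and> (\<forall>x. x \<notin> {3, 4, 5} \<longrightarrow> reg t x = reg s x) \<and> reg t 3 = int (bound (reg s 2))"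
    show "runs (Seq ?min ?c3) t (2 * (n * (4 * n + 6)) + ?T + 9) ?Q"
    proof (rule runs_Seq)
      show "runs ?min t 2 (\<lambda>t. base (2 * n) t \<and> reg t 3 = int g)"
        by (rule runs_loop_free) (use t s in \<open>auto simp: base_def g min_def\<close>)
    qed (rule 3, auto)
  qed (use s in simp)
qed

text \<open>The counter starts at 1, so the empty set is represented by \<open>2 ^ g\<close>, whose
  low \<open>g\<close> digits vanish; other sets have their usual binary code.\<close>

lemma bit_pattern:
  assumes "D \<subseteq> {..<g}"
  shows "\<exists>j\<in>{1..2 ^ g}. \<forall>i<g. odd ((j :: nat) div 2 ^ i) \<longleftrightarrow> i \<in> D"
proof (cases "D = {}")
  case True
  have "even ((2 :: nat) ^ g div 2 ^ i)" if "i < g" for i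
    using that by (simp add: power_diff[symmetric])
  then show ?thesis using True by (intro bexI[of _ "2 ^ g"]) auto
next
  case False
  have fin: "finite D" using assms finite_subset by auto
  have "set_encode D \<le> set_encode {..<g}"
    unfolding set_encode_def using assms by (intro sum_mono2) auto
  also have "\<dots> < 2 ^ g" by (simp add: set_encode_def lessThan_atLeast0 sum_power2)
  finally have "set_encode D \<le> 2 ^ g" by simp
  moreover have "set_encode D \<noteq> 0" using fin False by (auto simp: set_encode_def)
  moreover have "odd (set_encode D div 2 ^ i) \<longleftrightarrow> i \<in> D" for i
    using set_encode_inverse[OF fin] unfolding set_decode_def by blast
  ultimately show ?thesis by (intro bexI[of _ "set_encode D"]) auto
qed

lemma cand_size_eq_count: "cand_size g k j i = count (cand g k j) i"
  by (induction i) (auto simp: cand_def)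

text \<open>The first \<open>g\<close> ranks contribute \<open>card D\<close>; from there on every
  rank is taken until the size is \<open>k\<close>, so the tail is an interval of length
  \<open>m\<close>.\<close>

lemma cand_eq:
  assumes D: "D \<subseteq> {..<g}" and j: "\<And>i. i < g \<Longrightarrow> odd (j div 2 ^ i) \<longleftrightarrow> i \<in> D"
    and k: "k = int (card D + m)"
  shows "cand g k j i \<longleftrightarrow> i \<in> D \<union> {g..<g + m}"
proof (cases "i < g")
  case True
  then show ?thesis using j by (auto simp: cand_def)
next
  case False
  have "{l. l < g \<and> cand g k j l} = D" using D j by (auto simp: cand_def)
  then have size_g: "cand_size g k j g = card D" by (simp add: cand_size_eq_count count_def)
  have "cand_size g k j (g + l) = card D + min l m" for l
    by (induction l) (use size_g k in auto)
  from this[of "i - g"] show ?thesis using False D by (auto simp: cand_def k)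
qed

lemma finite_graph_nsets:
  fixes n :: nat
  assumes "E \<subseteq> nsets {..<n} 2"
  shows "finite_graph {..<n} (\<lambda>u v. {u, v} \<in> E)"
proof
  have *: "u < n \<and> v < n \<and> u \<noteq> v" if "{u, v} \<in> E" for u v
    using that assms by (auto simp: nsets_def card_2_iff doubleton_eq_iff)
  show "u \<in> {..<n} \<and> v \<in> {..<n}" if "{u, v} \<in> E" for u v using *[OF that] by simp
  show "\<not> {u, u} \<in> E" for u using * by blast
qed (simp_all add: insert_commute)

text \<open>An edge meeting \<open>S\<close> in one vertex has a unique orientation that leaves
  \<open>S\<close>.\<close>

lemma card_cut_edges:
  fixes n :: nat
  assumes E: "E \<subseteq> nsets {..<n} 2"
  shows "card (cut_edges E S) = card (finite_graph.cut (\<lambda>u v. {u, v} \<in> E) S)"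
proof -
  interpret finite_graph "{..<n}" "\<lambda>u v. {u, v} \<in> E" by (rule finite_graph_nsets[OF E])
  have "bij_betw (\<lambda>(u, v). {u, v}) (cut S) (cut_edges E S)"
    unfolding bij_betw_def
  proof
    show "inj_on (\<lambda>(u, v). {u, v}) (cut S)"
      by (auto simp: inj_on_def cut_def doubleton_eq_iff)
    show "(\<lambda>(u, v). {u, v}) ` cut S = cut_edges E S"
    proof (intro equalityI subsetI)
      fix e assume "e \<in> (\<lambda>(u, v). {u, v}) ` cut S"
      then show "e \<in> cut_edges E S" by (auto simp: cut_def cut_edges_def)
    next
      fix e assume e: "e \<in> cut_edges E S"
      then obtain a b where ab: "e = {a, b}" "a \<noteq> b"
        using E by (auto simp: cut_edges_def nsets_def card_2_iff)
      with e have "a \<in> S \<and> b \<notin> S \<or> b \<in> S \<and> a \<notin> S"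
        by (cases "a \<in> S"; cases "b \<in> S") (auto simp: cut_edges_def)
      then have "(a, b) \<in> cut S \<or> (b, a) \<in> cut S"
        using e ab by (auto simp: cut_edges_def cut_def insert_commute)
      then show "e \<in> (\<lambda>(u, v). {u, v}) ` cut S" using ab by (auto simp: insert_commute)
    qed
  qed
  then show ?thesis by (rule bij_betw_same_card[symmetric])
qed

text \<open>An accepted candidate is itself a solution. The converse carries
  \<open>cut_from_top_degrees\<close> from vertices to ranks along the bijection
  \<open>r\<close>.\<close>

lemma max_k_cut_iff_accepts:
  fixes k p :: int
  assumes E: "E \<subseteq> nsets {..<n} 2" and adj: "adj = (\<lambda>u v. {u, v} \<in> E)"
    and g: "g = min (bound p) n" and r: "r = rank (\<lambda>u. count (adj u) n) n"
  shows "max_k_cut {..<n} E k p \<longleftrightarrow> (\<exists>j\<in>{1..2 ^ g}. accepts g k p adj r n j)"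
proof -
  interpret finite_graph "{..<n}" adj unfolding adj by (rule finite_graph_nsets[OF E])
  have cut_edges: "card (cut_edges E S) = card (cut S)" for S
    unfolding adj by (rule card_cut_edges[OF E])
  have bij: "bij_betw r {..<n} {..<n}" unfolding r by (rule bij_betw_rank)
  then have inj: "inj_on r {..<n}" and img: "r ` {..<n} = {..<n}" by (auto simp: bij_betw_def)
  have card_preimage: "card {u. u < n \<and> r u \<in> X} = card X" if "X \<subseteq> {..<n}" for X
  proof -
    have "r ` {u. u < n \<and> r u \<in> X} = X" using that img by (auto simp: image_iff)
    moreover have "inj_on r {u. u < n \<and> r u \<in> X}" using inj by (rule inj_on_subset) auto
    ultimately show ?thesis using card_image by metis
  qed
  have accepts_iff: "accepts g k p adj r n j \<longleftrightarrow>
    int (card {u. u < n \<and> cand g k j (r u)}) = k \<and> p \<le> int (card (cut {u. u < n \<and> cand g k j (r u)}))" for j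
  proof -
    have "{u. u < n \<and> cand g k j (r u)} = {u. u < n \<and> r u \<in> {i. i < n \<and> cand g k j i}}"
      using img by auto
    then have "cand_size g k j n = card {u. u < n \<and> cand g k j (r u)}"
      using card_preimage[of "{i. i < n \<and> cand g k j i}"] by (simp add: cand_size_eq_count count_def subset_eq)
    moreover have "(\<Sum>u<n. count (\<lambda>v. adj u v \<and> cand g k j (r u) \<and> \<not> cand g k j (r v)) n) =
      card (cut {u. u < n \<and> cand g k j (r u)})"
    proof -
      have "cut {u. u < n \<and> cand g k j (r u)} =
        (SIGMA u:{..<n}. {v. v < n \<and> adj u v \<and> cand g k j (r u) \<and> \<not> cand g k j (r v)})"
        using adj_V by (auto simp: cut_def)
      then show ?thesis by (simp add: count_def)
    qed
    ultimately show ?thesis by (simp add: accepts_def)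
  qed
  show ?thesis
  proof
    assume "\<exists>j\<in>{1..2 ^ g}. accepts g k p adj r n j"
    then obtain j where "accepts g k p adj r n j" ..
    then show "max_k_cut {..<n} E k p"
      unfolding max_k_cut_def accepts_iff
      by (intro exI[of _ "{u. u < n \<and> cand g k j (r u)}"]) (auto simp: cut_edges)
  next
    assume "max_k_cut {..<n} E k p"
    then obtain W where W: "W \<subseteq> {..<n}" "int (card W) = k" "p \<le> int (card (cut W))"
      by (auto simp: max_k_cut_def cut_edges)
    have cardW: "card W \<le> n" using card_mono[OF _ W(1)] by simp
    have "\<exists>D m. D \<subseteq> {..<g} \<and> m \<le> n - g \<and> card D + m = card W \<and>
      p \<le> int (card (cut {u. u < n \<and> r u \<in> D \<union> {g..<g + m}}))"
    proof -
      \<comment> \<open>For \<open>p \<le> 0\<close> the bound is 0, and the first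
        \<open>card W\<close> ranks suffice. For \<open>g = n\<close> all subsets are enumerated.
        Only the third case needs the structural theorem.\<close>
      consider "p \<le> 0" | "g = n" | "0 < p" "g = bound p" "g < n" using g by linarith
      then show ?thesis
      proof cases
        case 1
        then show ?thesis using cardW g by (intro exI[of _ "{}"] exI[of _ "card W"]) (auto simp: bound_def)
      next
        case 2
        have "{u. u < n \<and> r u \<in> r ` W} = W" using W(1) inj by (auto dest: inj_onD)
        moreover have "card (r ` W) = card W" using inj W(1) card_image inj_on_subset by blast
        ultimately show ?thesis using W 2 img by (intro exI[of _ "r ` W"] exI[of _ 0]) auto
      next
        case 3
        define T where "T = {u. u < n \<and> r u \<in> {..<g}}"
        define F where "F = (\<lambda>m. {u. u < n \<and> r u \<in> {g..<g + m}})"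
        have cardT: "card T = g" unfolding T_def using 3 by (subst card_preimage) auto
        have VT: "{..<n} - T = {u. u < n \<and> r u \<in> {g..<n}}" unfolding T_def using img by auto
        have cardVT: "card ({..<n} - T) = n - g" unfolding VT by (subst card_preimage) auto
        have deg: "degree u = count (adj u) n" for u
          unfolding degree_def count_def nbhd_def using adj_V by (intro arg_cong[where f = card]) auto
        have "\<exists>S m. S \<subseteq> T \<and> m \<le> card ({..<n} - T) \<and> card S + m = card W \<and> nat p \<le> card (cut (S \<union> F m))"
        proof (rule cut_from_top_degrees)
          show "degree v \<le> degree u" if "u \<in> T" "v \<in> {..<n} - T" for u v
            using that degree_antimono_rank[of v n "\<lambda>u. count (adj u) n" u]
            unfolding deg by (auto simp: T_def r)
          show "F m \<subseteq> {..<n} - T \<and> card (F m) = m" if "m \<le> card ({..<n} - T)" for m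
          proof
            show "F m \<subseteq> {..<n} - T" by (auto simp: F_def T_def)
            show "card (F m) = m" unfolding F_def using that 3 cardVT by (subst card_preimage) auto
          qed
        qed (use W 3 cardT in \<open>auto simp: T_def bound_def\<close>)
        then obtain S m where S: "S \<subseteq> T" "m \<le> n - g" "card S + m = card W" "nat p \<le> card (cut (S \<union> F m))"
          using cardVT by auto
        have "S \<subseteq> {..<n}" using S(1) by (auto simp: T_def)
        then have "{u. u < n \<and> r u \<in> r ` S} = S" using inj by (auto dest: inj_onD)
        then have "{u. u < n \<and> r u \<in> r ` S \<union> {g..<g + m}} = S \<union> F m" unfolding F_def by blast
        moreover have "card (r ` S) = card S"
          using inj \<open>S \<subseteq> {..<n}\<close> card_image inj_on_subset by blast
        moreover have "r ` S \<subseteq> {..<g}" using S(1) by (auto simp: T_def)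
        ultimately show ?thesis using S 3 by (intro exI[of _ "r ` S"] exI[of _ m]) auto
      qed
    qed
    then obtain D m where D: "D \<subseteq> {..<g}" "m \<le> n - g" "card D + m = card W"
      "p \<le> int (card (cut {u. u < n \<and> r u \<in> D \<union> {g..<g + m}}))" by blast
    obtain j :: nat where j: "j \<in> {1..2 ^ g}" "\<forall>i<g. odd (j div 2 ^ i) \<longleftrightarrow> i \<in> D"
      using bit_pattern[OF D(1)] by blast
    have cand: "cand g k j i \<longleftrightarrow> i \<in> D \<union> {g..<g + m}" for i
      by (rule cand_eq[OF D(1) j(2)[rule_format]]) (use D(3) W(2) in auto)
    have "card (D \<union> {g..<g + m}) = card D + m"
      using D(1) by (subst card_Un_disjoint) (auto dest: finite_subset)
    moreover have "D \<union> {g..<g + m} \<subseteq> {..<n}" using D g by auto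
    ultimately have "card {u. u < n \<and> r u \<in> D \<union> {g..<g + m}} = card W"
      using card_preimage D(3) by metis
    then have "accepts g k p adj r n j" unfolding accepts_iff cand using W(2) D(4) by simp
    then show "\<exists>j\<in>{1..2 ^ g}. accepts g k p adj r n j" using j(1) by blast
  qed
qed

section \<open>The time bound and the input encoding\<close>

definition time_factor :: "int \<Rightarrow> nat" where
  "time_factor p = 100 * 2 ^ bound p"

text \<open>The power of two is obtained by doubling 100 \<open>bound x\<close> times; the argument
  is first copied to register 2, where \<open>bound_prog\<close> reads it.\<close>

lemma computable_time_factor: "computable time_factor"
proof -
  define c where "c = Seq (Assign 2 (Reg 0)) (Seq bound_prog (Seq (Assign 5 (Const 100))
    (Seq (For 4 (Reg 3) (Assign 5 (Plus (Reg 5) (Reg 5)))) (Assign 0 (Reg 5)))))"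
  have "\<exists>T. runs c \<lparr>reg = (\<lambda>_. 0)(0 := x), mem = (\<lambda>_. 0)\<rparr> T (\<lambda>s'. reg s' 0 = int (time_factor x))" for x
  proof (intro exI)
    let ?s = "\<lparr>reg = (\<lambda>_. 0)(0 := x), mem = (\<lambda>_. 0)\<rparr>"
    let ?b = "bound x"
    have 4: "runs (For 4 (Reg 3) (Assign 5 (Plus (Reg 5) (Reg 5)))) t (?b * 3 + 2) (\<lambda>t. reg t 5 = int (time_factor x))"
      if t: "reg t 3 = int ?b \<and> reg t 5 = 100" for t
      by (rule runs_For[where N = ?b and B = 1 and I = "\<lambda>i t. reg t 3 = int ?b \<and> reg t 5 = 100 * 2 ^ i"])
        (use t in \<open>auto simp: time_factor_def intro!: runs_loop_free\<close>)
    have 3: "runs (Seq (For 4 (Reg 3) (Assign 5 (Plus (Reg 5) (Reg 5)))) (Assign 0 (Reg 5))) t (?b * 3 + 2 + 1)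
        (\<lambda>t. reg t 0 = int (time_factor x))"
      if t: "reg t 3 = int ?b \<and> reg t 5 = 100" for t
      by (rule runs_Seq[OF 4[OF t]]) (auto intro: runs_loop_free)
    have 2: "runs (Seq (Assign 5 (Const 100)) (Seq (For 4 (Reg 3) (Assign 5 (Plus (Reg 5) (Reg 5)))) (Assign 0 (Reg 5))))
        t (1 + (?b * 3 + 2 + 1)) (\<lambda>t. reg t 0 = int (time_factor x))"
      if t: "reg t 3 = int ?b" for t
      by (rule runs_Seq[where P = "\<lambda>t. reg t 3 = int ?b \<and> reg t 5 = 100"])
        (use t 3 in \<open>auto intro: runs_loop_free\<close>)
    have 1: "runs (Seq bound_prog (Seq (Assign 5 (Const 100)) (Seq (For 4 (Reg 3) (Assign 5 (Plus (Reg 5) (Reg 5)))) (Assign 0 (Reg 5)))))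
        t (5 * nat x + 3 + (1 + (?b * 3 + 2 + 1))) (\<lambda>t. reg t 0 = int (time_factor x))"
      if t: "reg t 2 = x" for t
      by (rule runs_Seq[OF runs_bound_prog 2]) (use t in auto)
    show "runs c ?s (1 + (5 * nat x + 3 + (1 + (?b * 3 + 2 + 1)))) (\<lambda>s'. reg s' 0 = int (time_factor x))"
      unfolding c_def
    proof (rule runs_Seq)
      show "runs (Assign 2 (Reg 0)) ?s 1 (\<lambda>t. reg t 2 = x)" by (rule runs_loop_free) auto
    qed (rule 1, auto)
  qed
  then show ?thesis unfolding computable_def runs_def by meson
qed

text \<open>In units of \<open>M * N\<close> the summands cost at most 5, 20, 28 and 12, which 100
  covers generously. The term linear in \<open>p\<close> is absorbed through
  \<open>nat p \<le> bound p \<le> 2 ^ bound p\<close>.\<close>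

lemma time_bound:
  assumes "g = min (bound p) n"
  shows "5 * nat p + 2 * (n * (4 * n + 6)) + 2 ^ g * (n * 8 + n * (5 * n + 4) + 11) + 12
    \<le> time_factor p * max 1 n ^ 2"
proof -
  define N M where "N = (max 1 n)\<^sup>2" and "M = (2 :: nat) ^ bound p"
  have N: "1 \<le> N" "n \<le> N" "n * n \<le> N"
    unfolding N_def by (cases n; simp add: power2_eq_square)+
  have "nat p \<le> nat p * nat p" by (rule le_square)
  then have "nat p \<le> bound p" unfolding bound_def by linarith
  also have "bound p \<le> M" unfolding M_def by (rule less_imp_le[OF less_exp])
  finally have p: "nat p \<le> M * N" using N(1) by (metis mult.right_neutral mult_le_mono)
  have M: "1 \<le> M" by (simp add: M_def)
  then have NM: "N \<le> M * N" by simp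
  have "2 ^ g \<le> M" unfolding M_def using assms by (intro power_increasing) auto
  moreover have "n * 8 + n * (5 * n + 4) + 11 \<le> 28 * N" using N by (simp add: algebra_simps)
  ultimately have "2 ^ g * (n * 8 + n * (5 * n + 4) + 11) \<le> M * (28 * N)" by (rule mult_le_mono)
  moreover have "2 * (n * (4 * n + 6)) \<le> 20 * N" using N by (simp add: algebra_simps)
  moreover have "M * (28 * N) = 28 * (M * N)" by simp
  ultimately have "5 * nat p + 2 * (n * (4 * n + 6)) + 2 ^ g * (n * 8 + n * (5 * n + 4) + 11) + 12 \<le> 100 * (M * N)"
    using p NM N(1) by linarith
  then show ?thesis by (simp add: time_factor_def M_def N_def)
qed

lemma mem_cut_input:
  assumes "u < n" "v < n"
  shows "mem (cut_input n E k p) (int (u * n + v)) = of_bool ({u, v} \<in> E)"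
proof -
  \<comment> \<open>A matrix address determines row and column as quotient and remainder modulo
    \<open>n\<close>.\<close>
  have "i = u \<and> j = v" if "j < n" "u * n + v = i * n + j" for i j
  proof -
    have "(u * n + v) div n = u" "(i * n + j) div n = i" using that(1) assms by simp_all
    then have "u = i" using that(2) by simp
    then show ?thesis using that(2) by simp
  qed
  then have "(\<exists>i<n. \<exists>j<n. int (u * n + v) = int (i * n + j) \<and> {i, j} \<in> E) \<longleftrightarrow> {u, v} \<in> E"
    using assms unfolding of_nat_eq_iff by blast
  then show ?thesis by (simp add: cut_input_def del: of_nat_add of_nat_mult)
qed

theorem theorem15:
  "\<exists>(prog :: com) (f :: int \<Rightarrow> nat) (d :: nat). computable f \<and>
     (\<forall>(n :: nat) (E :: nat set set) (k :: int) (p :: int). E \<subseteq> nsets {..<n} 2 \<longrightarrow>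
        (\<exists>t s'. exec prog (cut_input n E k p) t s' \<and>
           t \<le> f p * (max 1 n) ^ d \<and>
           reg s' 0 = (if max_k_cut {..<n} E k p then 1 else 0)))"
proof (rule exI[of _ max_cut_prog], rule exI[of _ time_factor], rule exI[of _ 2], intro conjI allI impI)
  show "computable time_factor" by (rule computable_time_factor)
  fix n :: nat and E :: "nat set set" and k p :: int
  assume E: "E \<subseteq> nsets {..<n} 2"
  define adj where "adj = (\<lambda>u v. {u, v} \<in> E)"
  define g where "g = min (bound p) n"
  define r where "r = rank (\<lambda>u. count (adj u) n) n"
  have neg: "mem (cut_input n E k p) a = 0" if "a < 0" for a
  proof -
    have "a \<noteq> int m" for m using that by linarith
    then show ?thesis by (simp add: cut_input_def del: of_nat_add of_nat_mult)
  qed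
  have "runs max_cut_prog (cut_input n E k p)
      (5 * nat p + 2 * (n * (4 * n + 6)) + 2 ^ g * (n * 8 + n * (5 * n + 4) + 11) + 12)
      (\<lambda>s'. reg s' 0 = of_bool (\<exists>j\<in>{1..2 ^ g}. accepts g k p adj r n j))"
    by (rule runs_max_cut_prog[OF _ _ _ _ _ _ neg g_def r_def])
      (simp_all add: mem_cut_input adj_def del: of_nat_add of_nat_mult, simp_all add: cut_input_def)
  then have "runs max_cut_prog (cut_input n E k p) (time_factor p * max 1 n ^ 2)
      (\<lambda>s'. reg s' 0 = of_bool (max_k_cut {..<n} E k p))"
    unfolding max_k_cut_iff_accepts[OF E adj_def g_def r_def]
    by (rule runs_mono[OF _ time_bound[OF g_def]])
  then show "\<exists>t s'. exec max_cut_prog (cut_input n E k p) t s' \<and> t \<le> time_factor p * max 1 n ^ 2 \<and>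
      reg s' 0 = (if max_k_cut {..<n} E k p then 1 else 0)"
    by (simp add: runs_def of_bool_def)
qed

end
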